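(* Let $p$ be a prime, let $r\in\mathbb{Z}$, and let $m,n\in\mathbb{N}=\{0,1,2,\ldots\}$ with $m\neq n$ and $m\equiv n\pmod{p(p-1)}$. Then $$\frac{F_p(m,r)-F_p(n,r)}{m-n}\equiv\frac{(-1)^{n^*}}{n^*!}\sum_{1<k\le n^*}\binom{n^*}{k}\frac{B_k}{k}B^{(\{-n\}_p)}_{n^*-k}(-r) \equiv(-1)^{n_*-1}n_*!\sum_{1<k\le n^*}\binom{n_*+k}{n_*}r^{n^*-k}\sum_{1<j\le k}\binom kj\frac{B_j}{j}B^{(\{-n\}_p)}_{k-j}\pmod p.$$
   Context: For $n\in\mathbb{N}$ and $r\in\mathbb{Z}$ let $C_p(n,r)=\sum_{k\equiv r\,(\mathrm{mod}\ p)}\binom nk(-1)^k$ and define the Fleck quotient $F_p(n,r)=(-p)^{-\lfloor (n-1)/(p-1)\rfloor}C_p(n,r)+[\![n=0]\!]$, where $[\![A]\!]$ is $1$ if $A$ holds and $0$ otherwise (this is an integer). For an integer $x$ and modulus $M>0$, $\{x\}_M$ denotes the least nonnegative residue of $x$ modulo $M$. $n_*$ denotes the smallest positive residue of $n$ modulo $p-1$ (so $n_*\in\{1,\ldots,p-1\}$), and $n^*=\{-n\}_{p-1}$. For $m\in\mathbb{N}$ the $m$th order Bernoulli polynomials are defined by $\frac{x^me^{tx}}{(e^x-1)^m}=\sum_{k\ge0}B^{(m)}_k(t)\frac{x^k}{k!}$, with $B^{(m)}_k=B^{(m)}_k(0)$, $B_k(t)=B^{(1)}_k(t)$, $B_k=B_k(0)$.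 Congruences between rational numbers modulo $p$ mean that the difference divided by $p$ is a $p$-adic integer. *)

theory Defs
  imports
    "HOL-Computational_Algebra.Formal_Power_Series"
    "HOL-Computational_Algebra.Primes"
    "HOL-Number_Theory.Cong"
begin

text \<open>Since the binomial coefficient vanishes outside \<open>0 \<le> k \<le> n\<close>, summation over all
  integers \<open>k\<close> congruent to \<open>r\<close> modulo \<open>p\<close> reduces to the range below.\<close>

definition fleck_sum :: "nat \<Rightarrow> nat \<Rightarrow> int \<Rightarrow> int" where
  "fleck_sum p n r =
    (\<Sum>k\<in>{k::nat. k \<le> n \<and> [int k = r] (mod int p)}. int (n choose k) * (-1) ^ k)"

text \<open>The exponent of \<open>-p\<close> is an integer, and \<open>div\<close> on \<open>int\<close> is the floor of the quotient; for
  \<open>n = 0\<close> the floor is \<open>-1\<close>, so the power is \<open>-p\<close>. The value is an integer for every prime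
  \<open>p\<close>, but is taken here as a rational.\<close>

definition fleck_quotient :: "nat \<Rightarrow> nat \<Rightarrow> int \<Rightarrow> rat" where
  "fleck_quotient p n r =
    (- of_nat p) powi (- ((int n - 1) div (int p - 1))) * of_int (fleck_sum p n r)
      + of_bool (n = 0)"

definition least_nonneg_residue :: "int \<Rightarrow> int \<Rightarrow> nat" where
  "least_nonneg_residue x M = nat (x mod M)"

text \<open>In the paper's notation \<open>lower_star p n\<close> is \<open>n\<^sub>*\<close> and \<open>upper_star p n\<close> is \<open>n\<^sup>*\<close>.\<close>

definition lower_star :: "nat \<Rightarrow> nat \<Rightarrow> nat" where
  "lower_star p n = (LEAST k. 0 < k \<and> [k = n] (mod (p - 1)))"

definition upper_star :: "nat \<Rightarrow> nat \<Rightarrow> nat" where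
  "upper_star p n = least_nonneg_residue (- int n) (int p - 1)"

text \<open>The quotient of power series is exact: numerator and denominator both have order at
  least \<open>m\<close>, and the denominator has order exactly \<open>m\<close>.\<close>

definition bernoulli_poly_order :: "nat \<Rightarrow> nat \<Rightarrow> rat \<Rightarrow> rat" where
  "bernoulli_poly_order m k t =
    fact k * fps_nth (fps_X ^ m * fps_exp t / (fps_exp 1 - 1) ^ m) k"

definition bernoulli_number :: "nat \<Rightarrow> rat" where
  "bernoulli_number k = bernoulli_poly_order 1 k 0"

text \<open>For prime \<open>p\<close>, a rational number is a \<open>p\<close>-adic integer iff it is a fraction with
  denominator not divisible by \<open>p\<close>.\<close>

definition p_adic_integral :: "nat \<Rightarrow> rat \<Rightarrow> bool" where
  "p_adic_integral p x \<longleftrightarrow> (\<exists>a b :: int. \<not> int p dvd b \<and> x = of_int a / of_int b)"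

definition rat_cong :: "nat \<Rightarrow> rat \<Rightarrow> rat \<Rightarrow> bool" where
  "rat_cong p x y \<longleftrightarrow> p_adic_integral p ((x - y) / of_nat p)"

end

(*
  Let L(f) be the sum of the coefficients of an integer polynomial f at the exponents congruent to
  r modulo p; it kills the multiples of X^p - 1. There is a polynomial U with
  (1 - X)^p = 1 - X^p - p U (1 - X), so with n = (p - 1) q + d and 0 < d < p the Fleck quotient of
  n > 0 is L((1 - X)^d U^q). Writing U^p = U(X^p) + p V, the powers of U^p may be replaced by those
  of 1 + p V under L, and for odd p, (1 + p V)^t is 1 + p t V up to a p-adic multiple of p^2 t; hence the difference
  quotient of the Fleck quotients is congruent to - L((1 - X)^d U^q V). Modulo p, L(f) - f(1) is the
  coefficient of x^(p-1) in e^(-rx) f(e^x), by Fermat and Wilson. Under X = e^x the polynomial U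
  becomes x / (e^x - 1), and V becomes minus the series of B_k x^k / (k k!) with k > 1, both modulo p
  and x^(p-1). This gives the first sum; the second one follows from a! (p-1-a)! = (-1)^(a+1) mod p.
*)

theory Submission
  imports Defs "HOL-Number_Theory.Residues" "HOL-Computational_Algebra.Polynomial"
begin

section \<open>Rationals and power series modulo \<open>p\<close>\<close>

text \<open>The precision \<open>x^(p-1)\<close> is forced by \<open>(e^x - 1)/x\<close>, whose
  coefficient \<open>1/(k+1)!\<close> is \<open>p\<close>-integral only for
  \<open>k < p - 1\<close>. It suffices because \<open>1 - X\<close> becomes \<open>-x\<close> times
  that series: with \<open>d >= 1\<close> such factors only the coefficient of
  \<open>x^(p-1-d)\<close> of the remaining product matters. Modulo \<open>p\<close> this product is
  a power of \<open>b = x/(e^x - 1)\<close>, times the image of \<open>V\<close> and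
  \<open>e^(-rx)\<close>. Since \<open>b^p\<close> is congruent to \<open>1\<close>, the exponent
  \<open>q + (p-1) d\<close> counts modulo \<open>p\<close> only; it is congruent to
  \<open>-n\<close>, whence the order \<open>{-n}_p\<close>. Up to its linear term, \<open>V\<close>
  becomes the logarithm of \<open>b\<close>: coefficient \<open>k\<close> of a \<open>p\<close>-th
  power \<open>u^p\<close> is \<open>p/k\<close> times a coefficient of \<open>u^(p-1) u'\<close>,
  which behaves like \<open>u'/u\<close>, and \<open>x b'/b = 1 - b - x\<close> brings the Bernoulli
  numbers back. The linear term cancels against \<open>U(e^(px))\<close>, so the sums start at
  \<open>k = 2\<close>. Two cases stand apart. For \<open>n = 0\<close> the floor is
  \<open>-1\<close>, and a formula for multiples of \<open>p - 1\<close> takes over. For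
  \<open>p = 2\<close> the expansion of \<open>(1 + p V)^t\<close> is too coarse, but there
  \<open>U = X\<close> and both sides vanish.\<close>

lemma p_adic_integral_of_int [simp, intro]:
  assumes "prime p"
  shows "p_adic_integral p (of_int a)"
  unfolding p_adic_integral_def
  using assms by (intro exI[of _ a] exI[of _ 1]) (auto simp: prime_nat_iff)

lemma p_adic_integral_of_nat:
  "prime p \<Longrightarrow> p_adic_integral p (of_nat a)"
  using p_adic_integral_of_int[of p "int a"] by simp

lemma p_adic_integral_0: "prime p \<Longrightarrow> p_adic_integral p 0"
  using p_adic_integral_of_int[of p 0] by simp

lemma p_adic_integral_1: "prime p \<Longrightarrow> p_adic_integral p 1"
  using p_adic_integral_of_int[of p 1] by simp

lemma p_adic_integral_mult:
  assumes "prime p" "p_adic_integral p x" "p_adic_integral p y"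
  shows "p_adic_integral p (x * y)"
proof -
  obtain a b c d where
    "\<not> int p dvd b" "x = of_int a / of_int b" "\<not> int p dvd d" "y = of_int c / of_int d"
    using assms unfolding p_adic_integral_def by metis
  moreover from this have "\<not> int p dvd b * d"
    using assms(1) by (simp add: prime_dvd_mult_iff)
  ultimately show ?thesis
    unfolding p_adic_integral_def by (intro exI[of _ "a * c"] exI[of _ "b * d"]) auto
qed

lemma p_adic_integral_add:
  assumes "prime p" "p_adic_integral p x" "p_adic_integral p y"
  shows "p_adic_integral p (x + y)"
proof -
  obtain a b c d where
    *: "\<not> int p dvd b" "x = of_int a / of_int b" "\<not> int p dvd d" "y = of_int c / of_int d"
    using assms unfolding p_adic_integral_def by metis
  then have "\<not> int p dvd b * d"
    using assms(1) by (simp add: prime_dvd_mult_iff)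
  moreover have "x + y = of_int (a * d + c * b) / of_int (b * d)"
    using * by (subst *(2), subst *(4), subst add_frac_eq) auto
  ultimately show ?thesis
    unfolding p_adic_integral_def by blast
qed

lemma p_adic_integral_uminus:
  assumes "prime p" "p_adic_integral p x"
  shows "p_adic_integral p (- x)"
  using p_adic_integral_mult[OF assms(1) p_adic_integral_of_int[of p "-1"] assms(2)] assms(1)
  by simp

lemma p_adic_integral_diff:
  assumes "prime p" "p_adic_integral p x" "p_adic_integral p y"
  shows "p_adic_integral p (x - y)"
  using p_adic_integral_add[of p x "- y"] p_adic_integral_uminus assms by simp

lemma p_adic_integral_power:
  assumes "prime p" "p_adic_integral p x"
  shows "p_adic_integral p (x ^ k)"
  by (induction k) (use assms in \<open>auto intro: p_adic_integral_mult p_adic_integral_1\<close>)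

lemma p_adic_integral_sum:
  assumes "prime p" "\<And>i. i \<in> A \<Longrightarrow> p_adic_integral p (f i)"
  shows "p_adic_integral p (sum f A)"
  using assms(2)
  by (induction A rule: infinite_finite_induct)
    (use assms(1) in \<open>auto intro: p_adic_integral_add p_adic_integral_0\<close>)

lemma p_adic_integral_inverse_of_int:
  assumes "\<not> int p dvd b"
  shows "p_adic_integral p (1 / of_int b)"
  unfolding p_adic_integral_def using assms by (intro exI[of _ 1] exI[of _ b]) auto

lemma p_adic_integral_divide_of_int:
  assumes "prime p" "\<not> int p dvd b" "p_adic_integral p x"
  shows "p_adic_integral p (x / of_int b)"
  using p_adic_integral_mult[OF assms(1,3) p_adic_integral_inverse_of_int[OF assms(2)]] by simp

lemma p_adic_integral_divide_of_nat:
  assumes "prime p" "\<not> p dvd b" "p_adic_integral p x"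
  shows "p_adic_integral p (x / of_nat b)"
  using p_adic_integral_divide_of_int[of p "int b" x] assms by simp

lemma p_adic_integral_divide_fact:
  assumes "prime p" "k < p" "p_adic_integral p x"
  shows "p_adic_integral p (x / fact k)"
proof -
  have "\<not> p dvd fact k"
    using assms prime_dvd_fact_iff by auto
  from p_adic_integral_divide_of_nat[OF assms(1) this assms(3)] show ?thesis
    by simp
qed

lemmas p_adic_integral_intros =
  p_adic_integral_of_int p_adic_integral_of_nat p_adic_integral_0 p_adic_integral_1
  p_adic_integral_add p_adic_integral_diff p_adic_integral_uminus p_adic_integral_mult
  p_adic_integral_power p_adic_integral_sum

section \<open>Congruence of rationals modulo \<open>p\<close>\<close>

lemma rat_cong_refl: "prime p \<Longrightarrow> rat_cong p x x"
  by (simp add: rat_cong_def p_adic_integral_0)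

lemma rat_cong_add:
  assumes "prime p" "rat_cong p x x'" "rat_cong p y y'"
  shows "rat_cong p (x + y) (x' + y')"
  using p_adic_integral_add[OF assms(1) assms(2)[unfolded rat_cong_def] assms(3)[unfolded rat_cong_def]]
  by (simp add: rat_cong_def add_divide_distrib diff_divide_distrib algebra_simps)

lemma rat_cong_trans:
  assumes "prime p" "rat_cong p x y" "rat_cong p y z"
  shows "rat_cong p x z"
  using rat_cong_add[OF assms] by (simp add: rat_cong_def algebra_simps)

lemma rat_cong_sym:
  assumes "prime p" "rat_cong p x y"
  shows "rat_cong p y x"
  using p_adic_integral_uminus[OF assms(1) assms(2)[unfolded rat_cong_def]]
  by (simp add: rat_cong_def diff_divide_distrib)

text \<open>The splitting \<open>x * (y - y') + y' * (x - x')\<close> decides which two factors are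
  assumed integral; a congruence between rationals does not make either side integral.\<close>

lemma rat_cong_mult:
  assumes "prime p" "p_adic_integral p x" "p_adic_integral p y'"
    "rat_cong p x x'" "rat_cong p y y'"
  shows "rat_cong p (x * y) (x' * y')"
proof -
  have "(x * y - x' * y') / of_nat p = x * ((y - y') / of_nat p) + y' * ((x - x') / of_nat p)"
    by (simp add: diff_divide_distrib algebra_simps)
  then show ?thesis
    using assms unfolding rat_cong_def by (simp only: p_adic_integral_add p_adic_integral_mult)
qed

lemma rat_cong_mult_left:
  assumes "prime p" "p_adic_integral p c" "rat_cong p x y"
  shows "rat_cong p (c * x) (c * y)"
  using p_adic_integral_mult[OF assms(1,2) assms(3)[unfolded rat_cong_def]]
  by (simp add: rat_cong_def algebra_simps diff_divide_distrib)

lemma rat_cong_uminus: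
  assumes "prime p" "rat_cong p x y"
  shows "rat_cong p (- x) (- y)"
  using rat_cong_mult_left[OF assms(1) p_adic_integral_of_int[OF assms(1), of "-1"] assms(2)] by simp

lemma rat_cong_diff:
  assumes "prime p" "rat_cong p x x'" "rat_cong p y y'"
  shows "rat_cong p (x - y) (x' - y')"
  using rat_cong_add[OF assms(1,2) rat_cong_uminus[OF assms(1,3)]] by simp

lemma rat_cong_sum:
  assumes "prime p" "\<And>i. i \<in> A \<Longrightarrow> rat_cong p (f i) (g i)"
  shows "rat_cong p (sum f A) (sum g A)"
  using assms(2)
  by (induction A rule: infinite_finite_induct)
    (use assms(1) in \<open>auto intro: rat_cong_add rat_cong_refl\<close>)

lemma rat_cong_prime_mult_0:
  assumes "prime p" "p_adic_integral p x"
  shows "rat_cong p (of_nat p * x) 0"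
  using assms prime_gt_0_nat[of p] by (simp add: rat_cong_def)

section \<open>Power series over the \<open>p\<close>-integral rationals, truncated at
  \<open>x^N\<close>\<close>

definition fps_integral :: "nat \<Rightarrow> nat \<Rightarrow> rat fps \<Rightarrow> bool" where
  "fps_integral p N f \<longleftrightarrow> (\<forall>k<N. p_adic_integral p (fps_nth f k))"

definition fps_cong :: "nat \<Rightarrow> nat \<Rightarrow> rat fps \<Rightarrow> rat fps \<Rightarrow> bool" where
  "fps_cong p N f g \<longleftrightarrow> (\<forall>k<N. rat_cong p (fps_nth f k) (fps_nth g k))"

lemma fps_integral_mono: "fps_integral p N f \<Longrightarrow> M \<le> N \<Longrightarrow> fps_integral p M f"
  by (auto simp: fps_integral_def)

lemma fps_cong_mono: "fps_cong p N f g \<Longrightarrow> M \<le> N \<Longrightarrow> fps_cong p M f g"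
  by (auto simp: fps_cong_def)

lemma fps_integral_mult:
  assumes "prime p" "fps_integral p N f" "fps_integral p N g"
  shows "fps_integral p N (f * g)"
  using assms by (auto simp: fps_integral_def fps_mult_nth intro!: p_adic_integral_intros)

lemma fps_integral_1: "prime p \<Longrightarrow> fps_integral p N 1"
  by (auto simp: fps_integral_def intro!: p_adic_integral_intros)

lemma fps_integral_power:
  assumes "prime p" "fps_integral p N f"
  shows "fps_integral p N (f ^ k)"
  by (induction k) (use assms in \<open>auto intro: fps_integral_mult fps_integral_1\<close>)

lemma fps_integral_deriv:
  assumes "prime p" "fps_integral p (Suc N) f"
  shows "fps_integral p N (fps_deriv f)"
  using assms unfolding fps_integral_def fps_deriv_nth
  by (intro allI impI p_adic_integral_mult p_adic_integral_of_nat) auto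

text \<open>With constant coefficient \<open>1\<close>, the convolution identity is solved for the
  next coefficient of the inverse without any division, so integrality propagates by strong
  induction.\<close>

lemma fps_integral_inverse:
  assumes "prime p" "fps_integral p N f" "fps_nth f 0 = 1"
  shows "fps_integral p N (inverse f)"
  unfolding fps_integral_def
proof (intro allI impI)
  fix k assume "k < N"
  then show "p_adic_integral p (fps_nth (inverse f) k)"
  proof (induction k rule: less_induct)
    case (less k)
    have "f * inverse f = 1"
      using assms(3) by (simp add: inverse_mult_eq_1')
    then have "fps_nth 1 k = (\<Sum>i=0..k. fps_nth f i * fps_nth (inverse f) (k - i))"
      by (metis fps_mult_nth)
    also have "\<dots> = fps_nth (inverse f) k +
        (\<Sum>i=Suc 0..k. fps_nth f i * fps_nth (inverse f) (k - i))"
      using assms(3) by (simp add: sum.atLeast_Suc_atMost)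
    finally have *: "fps_nth (inverse f) k =
        fps_nth 1 k - (\<Sum>i=Suc 0..k. fps_nth f i * fps_nth (inverse f) (k - i))"
      by (simp only: algebra_simps)
    have "p_adic_integral p (fps_nth (inverse f) (k - i))" if "i \<in> {Suc 0..k}" for i
      using that less.prems by (intro less.IH) auto
    moreover have "p_adic_integral p (fps_nth f i)" if "i \<in> {Suc 0..k}" for i
      using that less.prems assms(2) by (auto simp: fps_integral_def)
    moreover have "p_adic_integral p (fps_nth 1 k)"
      using fps_integral_1[OF assms(1), of "Suc k"] by (auto simp: fps_integral_def)
    ultimately show ?case
      unfolding * using assms(1)
      by (intro p_adic_integral_diff p_adic_integral_sum p_adic_integral_mult)
  qed
qed

lemma fps_cong_refl: "prime p \<Longrightarrow> fps_cong p N f f"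
  by (simp add: fps_cong_def rat_cong_refl)

lemma fps_cong_sym: "prime p \<Longrightarrow> fps_cong p N f g \<Longrightarrow> fps_cong p N g f"
  by (simp add: fps_cong_def rat_cong_sym)

lemma fps_cong_trans:
  "prime p \<Longrightarrow> fps_cong p N f g \<Longrightarrow> fps_cong p N g h \<Longrightarrow> fps_cong p N f h"
  unfolding fps_cong_def using rat_cong_trans by blast

lemma fps_cong_mult:
  assumes "prime p" "fps_integral p N f" "fps_integral p N g'"
    "fps_cong p N f f'" "fps_cong p N g g'"
  shows "fps_cong p N (f * g) (f' * g')"
  using assms
  by (auto simp: fps_cong_def fps_integral_def fps_mult_nth intro!: rat_cong_sum rat_cong_mult)

lemma fps_cong_power:
  assumes "prime p" "fps_integral p N f" "fps_integral p N g" "fps_cong p N f g"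
  shows "fps_cong p N (f ^ k) (g ^ k)"
  by (induction k)
    (use assms in \<open>auto intro!: fps_cong_mult fps_integral_power intro: fps_cong_refl\<close>)

lemma fps_cong_deriv:
  assumes "prime p" "fps_cong p (Suc N) f g"
  shows "fps_cong p N (fps_deriv f) (fps_deriv g)"
  using assms unfolding fps_cong_def fps_deriv_nth
  by (intro allI impI rat_cong_mult_left p_adic_integral_of_nat) auto

text \<open>The derivative of \<open>f ^ p\<close> is divisible by \<open>p\<close>, and the factors \<open>k < p\<close> produced by
  differentiation are invertible modulo \<open>p\<close>.\<close>

lemma fps_power_prime_nth:
  fixes f :: "rat fps"
  assumes "prime p" "0 < k"
  shows "fps_nth (f ^ p) k =
    of_nat p * fps_nth (f ^ (p - 1) * fps_deriv f) (k - 1) / of_nat k"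
proof -
  have "of_nat k * fps_nth (f ^ p) k = fps_nth (fps_deriv (f ^ p)) (k - 1)"
    using assms(2) by simp
  also have "fps_deriv (f ^ p) = fps_const (of_nat p) * (f ^ (p - 1) * fps_deriv f)"
    by (simp add: fps_deriv_power mult_ac)
  also have "fps_nth \<dots> (k - 1) = of_nat p * fps_nth (f ^ (p - 1) * fps_deriv f) (k - 1)"
    by (rule fps_mult_left_const_nth)
  finally show ?thesis
    using assms(2) by (metis less_numeral_extra(3) nonzero_mult_div_cancel_left of_nat_eq_0_iff)
qed

lemma fps_cong_power_prime_1:
  assumes "prime p" "N \<le> p" "fps_integral p N f" "fps_nth f 0 = 1"
  shows "fps_cong p N (f ^ p) 1"
  unfolding fps_cong_def
proof (intro allI impI)
  fix k assume k: "k < N"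
  show "rat_cong p (fps_nth (f ^ p) k) (fps_nth 1 k)"
  proof (cases "k = 0")
    case True
    then show ?thesis
      using assms by (simp add: fps_power_zeroth rat_cong_refl)
  next
    case False
    have "fps_integral p k (f ^ (p - 1) * fps_deriv f)"
      using assms(1) k assms(3)
      by (intro fps_integral_mult fps_integral_power fps_integral_deriv)
        (auto intro: fps_integral_mono)
    then have "p_adic_integral p (fps_nth (f ^ (p - 1) * fps_deriv f) (k - 1) / of_nat k)"
      using False k assms(1,2)
      by (intro p_adic_integral_divide_of_nat) (auto simp: fps_integral_def dest: dvd_imp_le)
    from rat_cong_prime_mult_0[OF assms(1) this] show ?thesis
      using False by (simp add: fps_power_prime_nth[OF assms(1)])
  qed
qed

section \<open>Residue class sums of coefficients\<close>

definition residue_sum :: "nat \<Rightarrow> int \<Rightarrow> int poly \<Rightarrow> int" where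
  "residue_sum p r f = (\<Sum>k\<le>degree f. if [int k = r] (mod int p) then coeff f k else 0)"

lemma residue_sum_eq:
  assumes "degree f \<le> N"
  shows "residue_sum p r f = (\<Sum>k\<le>N. if [int k = r] (mod int p) then coeff f k else 0)"
  unfolding residue_sum_def using assms
  by (intro sum.mono_neutral_left) (auto simp: coeff_eq_0)

lemma residue_sum_0 [simp]: "residue_sum p r 0 = 0"
  unfolding residue_sum_def by (intro sum.neutral) simp

lemma residue_sum_pCons:
  "residue_sum p r (pCons a f) = of_bool ([0 = r] (mod int p)) * a + residue_sum p (r - 1) f"
proof -
  have "[int (Suc k) = r] (mod int p) \<longleftrightarrow> [int k = r - 1] (mod int p)" for k
    by (simp add: cong_iff_dvd_diff algebra_simps)
  moreover have "residue_sum p r (pCons a f) =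
      (\<Sum>k\<le>Suc (degree f). if [int k = r] (mod int p) then coeff (pCons a f) k else 0)"
    by (rule residue_sum_eq) (rule degree_pCons_le)
  ultimately show ?thesis
    by (simp only: sum.atMost_Suc_shift residue_sum_def coeff_pCons_0 coeff_pCons_Suc)
      auto
qed

lemma residue_sum_add: "residue_sum p r (f + g) = residue_sum p r f + residue_sum p r g"
proof -
  let ?N = "max (degree f) (degree g)"
  have "degree (f + g) \<le> ?N" "degree f \<le> ?N" "degree g \<le> ?N"
    by (auto intro: degree_add_le)
  then show ?thesis
    by (simp only: residue_sum_eq flip: sum.distrib) (intro sum.cong, auto)
qed

lemma residue_sum_smult: "residue_sum p r (smult c f) = c * residue_sum p r f"
  by (induction f arbitrary: r) (auto simp: residue_sum_pCons algebra_simps)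

lemma residue_sum_of_nat_mult: "residue_sum p r (of_nat c * f) = int c * residue_sum p r f"
  by (simp add: of_nat_poly residue_sum_smult)

lemma residue_sum_uminus: "residue_sum p r (- f) = - residue_sum p r f"
  using residue_sum_smult[of p r "-1" f] by simp

lemma residue_sum_diff: "residue_sum p r (f - g) = residue_sum p r f - residue_sum p r g"
  using residue_sum_add[of p r f "- g"] by (simp add: residue_sum_uminus)

lemma residue_sum_cong: "[r = s] (mod int p) \<Longrightarrow> residue_sum p r f = residue_sum p s f"
  unfolding residue_sum_def
  by (intro sum.cong refl) (meson cong_sym cong_trans)

lemma X_power_eq_monom: "[:0, 1:] ^ k = monom (1 :: 'a :: comm_semiring_1) k"
  by (simp add: monom_altdef)

lemma residue_sum_X_power_mult:
  "residue_sum p r ([:0, 1:] ^ k * f) = residue_sum p (r - int k) f"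
proof (induction k arbitrary: r)
  case (Suc k)
  have "[:0, 1:] ^ Suc k * f = pCons 0 ([:0, 1:] ^ k * f)"
    by (simp add: mult.assoc)
  then show ?case
    by (simp only: residue_sum_pCons Suc) (simp add: algebra_simps)
qed simp

lemma residue_sum_X_power_prime_mult: "residue_sum p r ([:0, 1:] ^ p * f) = residue_sum p r f"
  by (simp only: residue_sum_X_power_mult)
    (rule residue_sum_cong, simp add: cong_iff_dvd_diff)

text \<open>\<open>X ^ p\<close> acts as \<open>1\<close> under \<open>residue_sum\<close>, hence a
  polynomial in \<open>X ^ p\<close> acts as the scalar obtained at \<open>1\<close>.\<close>

lemma residue_sum_pcompose_mult:
  "residue_sum p r (pcompose f ([:0, 1:] ^ p) * h) = poly f 1 * residue_sum p r h"
proof (induction f arbitrary: h)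
  case (pCons a f)
  have "pcompose (pCons a f) ([:0, 1:] ^ p) * h =
      smult a h + [:0, 1:] ^ p * (pcompose f ([:0, 1:] ^ p) * h)"
    by (simp add: pcompose_pCons algebra_simps)
  then show ?case
    by (simp only: residue_sum_add residue_sum_smult residue_sum_X_power_prime_mult pCons.IH)
      (simp add: algebra_simps)
qed simp

text \<open>The geometric sum meets every residue class modulo \<open>p\<close> exactly once, so
  each coefficient of \<open>f\<close> is counted once, whatever the shift of its class. This
  handles \<open>(1 - X) ^ (p - 1)\<close> when \<open>p - 1\<close> divides
  \<open>n\<close>.\<close>

lemma residue_sum_power_sum_mult:
  assumes "prime p"
  shows "residue_sum p r ((\<Sum>k<p. [:0, 1:] ^ k) * f) = poly f 1"
proof (induction f arbitrary: r)
  case (pCons a f)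
  let ?\<Phi> = "\<Sum>k<p. [:0, 1:] ^ k :: int poly"
  have 1: "residue_sum p r ?\<Phi> = 1"
  proof -
    have p: "p > 0"
      using assms prime_gt_0_nat by auto
    have "coeff ?\<Phi> k = of_bool (k < p)" for k
      by (simp add: coeff_sum X_power_eq_monom)
    moreover have "degree ?\<Phi> \<le> p"
      by (intro degree_sum_le) (auto simp: X_power_eq_monom intro: order.trans[OF degree_monom_le])
    \<comment> \<open>The degree bound \<open>p\<close> overshoots by one:
      \<open>of_bool (k < p)\<close> removes the exponent \<open>p\<close>, which shares its class
      with \<open>0\<close>.\<close>
    ultimately have "residue_sum p r ?\<Phi> =
        (\<Sum>k\<le>p. if [int k = r] (mod int p) then of_bool (k < p) else 0)"
      by (simp add: residue_sum_eq cong: if_cong)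
    also have "\<dots> = (\<Sum>k\<in>{nat (r mod int p)}. 1)"
    proof (intro sum.mono_neutral_cong_right)
      show "{nat (r mod int p)} \<subseteq> {..p}"
        using p by (auto simp: nat_le_iff intro: less_imp_le)
    next
      show "\<forall>i\<in>{..p} - {nat (r mod int p)}.
          (if [int i = r] (mod int p) then of_bool (i < p) else 0) = (0::int)"
        by (auto simp: cong_def)
    qed (use p in \<open>auto simp: cong_def nat_less_iff\<close>)
    finally show ?thesis
      by simp
  qed
  have "?\<Phi> * pCons a f = smult a ?\<Phi> + pCons 0 (?\<Phi> * f)"
    by simp
  then show ?case
    by (simp only: residue_sum_add residue_sum_smult residue_sum_pCons pCons.IH 1) simp
qed simp

lemma coeff_one_minus_X_power:
  "coeff ([:1, -1:] ^ n) k = (int (n choose k) * (-1) ^ k)"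
proof (induction n arbitrary: k)
  case (Suc n)
  have "coeff ([:1, -1:] ^ Suc n :: int poly) k =
      coeff ([:1, -1:] ^ n) k - coeff (pCons 0 ([:1, -1:] ^ n)) k"
    by (cases k) simp_all
  then show ?case
    by (cases k) (simp_all only: Suc coeff_pCons_0 coeff_pCons_Suc, simp_all add: algebra_simps)
qed (simp add: binomial_eq_0 coeff_1)

lemma fleck_sum_eq_residue_sum: "fleck_sum p n r = residue_sum p r ([:1, -1:] ^ n)"
  unfolding fleck_sum_def residue_sum_def coeff_one_minus_X_power
  by (simp add: degree_power_eq sum.If_cases Collect_conj_eq atMost_def)

section \<open>Congruences for powers\<close>

lemma prime_dvd_power_add_diff:
  fixes x y :: "'a :: comm_ring_1"
  assumes "prime p"
  shows "of_nat p dvd (x + y) ^ p - (x ^ p + y ^ p)"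
proof -
  have p: "p > 0"
    using assms prime_gt_0_nat by auto
  have "(x + y) ^ p = (\<Sum>k\<in>insert 0 (insert p {0<..<p}). of_nat (p choose k) * x ^ k * y ^ (p - k))"
    unfolding binomial_ring using p by (intro sum.cong) auto
  also have "\<dots> = x ^ p + y ^ p + (\<Sum>k\<in>{0<..<p}. of_nat (p choose k) * x ^ k * y ^ (p - k))"
    using p by (simp add: algebra_simps)
  finally have "(x + y) ^ p - (x ^ p + y ^ p) =
      (\<Sum>k\<in>{0<..<p}. of_nat (p choose k) * x ^ k * y ^ (p - k))"
    by simp
  also have "of_nat p dvd \<dots>"
  proof (intro dvd_sum dvd_mult2)
    fix k assume "k \<in> {0<..<p}"
    then have "p dvd p choose k"
      using assms p by (intro dvd_choose_prime) auto
    then show "(of_nat p :: 'a) dvd of_nat (p choose k)"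
      by (auto elim!: dvdE)
  qed
  finally show ?thesis .
qed

text \<open>Both cases sit in one formula because the power \<open>p - 1\<close> later serves as the
  indicator of a residue class.\<close>

lemma fermat_int:
  fixes a :: int
  assumes "prime p"
  shows "[a ^ (p - 1) = of_bool (\<not> int p dvd a)] (mod int p)"
proof (cases "int p dvd a")
  case True
  then show ?thesis
    using assms prime_gt_1_nat[of p] by (auto simp: cong_0_iff intro: dvd_power_le dvd_trans)
next
  case False
  define b where "b = nat (a mod int p)"
  have b: "int b = a mod int p"
    using assms prime_gt_0_nat[of p] by (simp add: b_def)
  have "\<not> p dvd b"
    using False by (metis b dvd_mod_iff dvd_refl int_dvd_int_iff)
  then have "[b ^ (p - 1) = 1] (mod p)"
    using fermat_theorem assms by blast
  then have "[int (b ^ (p - 1)) = int 1] (mod int p)"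
    by (simp only: cong_int_iff)
  then have "[(a mod int p) ^ (p - 1) = 1] (mod int p)"
    by (simp add: b)
  then have "[a ^ (p - 1) = 1] (mod int p)"
    by (simp add: cong_def power_mod)
  then show ?thesis
    using False by simp
qed

text \<open>Modulo \<open>p\<close> the Frobenius map is additive and, by Fermat, fixes integer
  constants, so its only effect is to replace \<open>X\<close> by \<open>X ^ p\<close>. Applied to
  \<open>1 - X\<close> it produces \<open>U\<close>; applied to \<open>U\<close> it produces
  \<open>V\<close>.\<close>

lemma prime_dvd_power_diff_pcompose:
  fixes f :: "int poly"
  assumes "prime p"
  shows "of_nat p dvd f ^ p - pcompose f ([:0, 1:] ^ p)"
proof (induction f)
  case 0
  then show ?case
    using assms prime_gt_0_nat[of p] by (simp add: power_0_left)
next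
  case (pCons a f)
  define X where "X = ([:0, 1:] :: int poly)"
  have "int p dvd a ^ p - a"
  proof -
    have "a ^ p - a = a * (a ^ (p - 1) - 1)"
      using assms prime_gt_0_nat[of p] by (simp add: power_eq_if algebra_simps)
    then show ?thesis
      using fermat_int[OF assms, of a] by (cases "int p dvd a") (auto simp: cong_iff_dvd_diff)
  qed
  then obtain c where "a ^ p - a = int p * c" ..
  then have "[:a:] ^ p - [:a:] = of_nat p * [:c:]"
    by (simp add: poly_const_pow of_nat_poly)
  then have 1: "of_nat p dvd [:a:] ^ p - [:a:]"
    by (simp only: dvd_triv_left)
  have 2: "of_nat p dvd ([:a:] + X * f) ^ p - ([:a:] ^ p + (X * f) ^ p)"
    using prime_dvd_power_add_diff[OF assms] .
  have 3: "of_nat p dvd X ^ p * (f ^ p - pcompose f (X ^ p))"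
    using pCons.IH unfolding X_def by (rule dvd_mult)
  have eq: "pCons a f = [:a:] + X * f" "pcompose (pCons a f) (X ^ p) = [:a:] + X ^ p * pcompose f (X ^ p)"
    by (simp_all only: pcompose_pCons) (simp add: X_def)
  have "pCons a f ^ p - pcompose (pCons a f) (X ^ p) =
      (([:a:] + X * f) ^ p - ([:a:] ^ p + (X * f) ^ p)) + ([:a:] ^ p - [:a:]) +
        X ^ p * (f ^ p - pcompose f (X ^ p))"
    by (subst eq(2), subst eq(1)) (simp add: power_mult_distrib algebra_simps)
  then show ?case
    unfolding X_def[symmetric] using 1 2 3 by (simp only: dvd_add)
qed

section \<open>Expansion of powers of \<open>1 + p x\<close>\<close>

lemma one_plus_power:
  fixes z :: "'a :: comm_ring_1"
  shows "\<exists>w. (1 + z) ^ s = 1 + of_nat s * z + z\<^sup>2 * w"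
proof (induction s)
  case (Suc s)
  then obtain w where "(1 + z) ^ s = 1 + of_nat s * z + z\<^sup>2 * w" ..
  then have "(1 + z) ^ Suc s = 1 + of_nat (Suc s) * z + z\<^sup>2 * (w + of_nat s + z * w)"
    by (simp add: algebra_simps power2_eq_square)
  then show ?case ..
qed (auto intro: exI[of _ 0])

text \<open>Parity enters here: among primes, \<open>p choose 2\<close> is divisible by
  \<open>p\<close> exactly for odd \<open>p\<close>, which gives the quadratic term its extra factor
  \<open>p\<close>.\<close>

lemma one_plus_power_odd_prime:
  fixes z :: "'a :: comm_ring_1"
  assumes "prime p" "odd p"
  shows "\<exists>v w. (1 + z) ^ p = 1 + of_nat p * z + of_nat p * z\<^sup>2 * v + z ^ 3 * w"
proof -
  have p: "p \<ge> 3"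
    using assms prime_ge_2_nat[of p] by (cases "p = 2") auto
  have "(1 + z) ^ p = (\<Sum>k\<le>p. of_nat (p choose k) * z ^ k)"
    using binomial_ring[of z 1 p] by (simp add: add.commute)
  also have "{..p} = {0,1,2} \<union> {3..p}"
    using p by auto
  also have "(\<Sum>k\<in>{0,1,2} \<union> {3..p}. of_nat (p choose k) * z ^ k) =
      1 + of_nat p * z + of_nat (p choose 2) * z\<^sup>2 + (\<Sum>k\<in>{3..p}. of_nat (p choose k) * z ^ k)"
    by (subst sum.union_disjoint) (auto simp: algebra_simps)
  finally have "(1 + z) ^ p = 1 + of_nat p * z + of_nat (p choose 2) * z\<^sup>2 +
      (\<Sum>k\<in>{3..p}. of_nat (p choose k) * z ^ k)" .
  moreover have "z ^ 3 dvd (\<Sum>k\<in>{3..p}. of_nat (p choose k) * z ^ k)"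
    by (intro dvd_sum dvd_mult le_imp_power_dvd) auto
  moreover have "p dvd p choose 2"
    using assms p by (intro dvd_choose_prime) auto
  ultimately show ?thesis
    by (elim dvdE) (auto simp: mult_ac)
qed

text \<open>For \<open>z = p^(a+1) y\<close> the terms with \<open>p z^2\<close> and
  \<open>z^3\<close> carry \<open>p^(2a+3)\<close> and \<open>p^(3a+3)\<close>, both divisible by
  \<open>p^(a+3)\<close>. At \<open>a = 0\<close> there is no slack.\<close>

lemma one_plus_prime_power:
  fixes x :: "'a :: comm_ring_1"
  assumes "prime p" "odd p"
  shows "\<exists>w. (1 + of_nat p * x) ^ (p ^ a) = 1 + of_nat p ^ (a + 1) * x + of_nat p ^ (a + 2) * w"
proof (induction a)
  case 0
  show ?case
    by (rule exI[of _ 0]) simp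
next
  case (Suc a)
  then obtain w where w:
    "(1 + of_nat p * x) ^ (p ^ a) = 1 + of_nat p ^ (a + 1) * x + of_nat p ^ (a + 2) * w" ..
  define y where "y = x + of_nat p * w"
  obtain u v where uv: "(1 + of_nat p ^ (a + 1) * y) ^ p =
      1 + of_nat p * (of_nat p ^ (a + 1) * y) + of_nat p * (of_nat p ^ (a + 1) * y)\<^sup>2 * u +
        (of_nat p ^ (a + 1) * y) ^ 3 * v"
    using one_plus_power_odd_prime[OF assms, of "of_nat p ^ (a + 1) * y"] by (elim exE)
  have "1 + of_nat p ^ (a + 1) * x + of_nat p ^ (a + 2) * w = 1 + of_nat p ^ (a + 1) * y"
    by (simp add: y_def algebra_simps)
  then have "(1 + of_nat p * x) ^ (p ^ Suc a) = (1 + of_nat p ^ (a + 1) * y) ^ p"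
    by (simp only: power_Suc2 power_mult w)
  also have "\<dots> = 1 + of_nat p * (of_nat p ^ (a + 1) * y) + of_nat p ^ (Suc a + 2) *
      (of_nat p ^ a * y\<^sup>2 * u + of_nat p ^ a * of_nat p ^ a * y ^ 3 * v)"
    unfolding uv by (simp add: algebra_simps power2_eq_square power3_eq_cube)
  also have "of_nat p * (of_nat p ^ (a + 1) * y) =
      of_nat p ^ (Suc a + 1) * x + of_nat p ^ (Suc a + 2) * w"
    by (simp add: y_def algebra_simps)
  finally have "(1 + of_nat p * x) ^ (p ^ Suc a) =
      1 + of_nat p ^ (Suc a + 1) * x + of_nat p ^ (Suc a + 2) *
        (w + (of_nat p ^ a * y\<^sup>2 * u + of_nat p ^ a * of_nat p ^ a * y ^ 3 * v))"
    by (simp only: distrib_left add.assoc)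
  then show ?case ..
qed

text \<open>The error is measured by \<open>p^(a+2)\<close>. When \<open>s\<close> is prime to
  \<open>p\<close>, division by \<open>p * (p^a * s)\<close> leaves \<open>p\<close> times a
  \<open>p\<close>-integral number, so the error disappears in difference quotients.\<close>

lemma one_plus_prime_mult_power:
  fixes x :: "'a :: comm_ring_1"
  assumes "prime p" "odd p"
  shows "\<exists>w. (1 + of_nat p * x) ^ (p ^ a * s) =
    1 + of_nat p * of_nat (p ^ a * s) * x + of_nat (p ^ (a + 2)) * w"
proof -
  obtain w where w:
    "(1 + of_nat p * x) ^ (p ^ a) = 1 + of_nat p ^ (a + 1) * x + of_nat p ^ (a + 2) * w"
    using one_plus_prime_power[OF assms] by blast
  define y where "y = x + of_nat p * w"
  have "1 + of_nat p ^ (a + 1) * x + of_nat p ^ (a + 2) * w = 1 + of_nat p ^ (a + 1) * y"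
    by (simp add: y_def algebra_simps)
  then have "(1 + of_nat p * x) ^ (p ^ a * s) = (1 + of_nat p ^ (a + 1) * y) ^ s"
    by (simp only: power_mult w)
  also obtain v where "\<dots> =
      1 + of_nat s * (of_nat p ^ (a + 1) * y) + (of_nat p ^ (a + 1) * y)\<^sup>2 * v"
    using one_plus_power[of "of_nat p ^ (a + 1) * y" s] by (elim exE)
  also have "of_nat s * (of_nat p ^ (a + 1) * y) =
      of_nat p * of_nat (p ^ a * s) * x + of_nat (p ^ (a + 2)) * (of_nat s * w)"
    by (simp add: y_def algebra_simps)
  also have "(of_nat p ^ (a + 1) * y)\<^sup>2 * v = of_nat (p ^ (a + 2)) * (of_nat p ^ a * y\<^sup>2 * v)"
    by (simp add: algebra_simps power2_eq_square)
  finally have "(1 + of_nat p * x) ^ (p ^ a * s) = 1 + of_nat p * of_nat (p ^ a * s) * x +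
      of_nat (p ^ (a + 2)) * (of_nat s * w + of_nat p ^ a * y\<^sup>2 * v)"
    by (simp only: distrib_left add.assoc)
  then show ?thesis ..
qed

section \<open>The Fleck quotient as a residue class sum\<close>

text \<open>Modulo the cyclotomic polynomial, \<open>(1 - X) ^ (p - 1)\<close> is \<open>-p\<close> times the unit
  \<open>U\<close>.\<close>

lemma one_minus_X_power_prime_ex:
  assumes "prime p"
  shows "\<exists>U :: int poly. [:1, -1:] ^ p = 1 - [:0, 1:] ^ p - of_nat p * U * [:1, -1:]"
proof -
  obtain Q :: "int poly" where
    Q: "[:1, -1:] ^ p - pcompose [:1, -1:] ([:0, 1:] ^ p) = of_nat p * Q"
    using prime_dvd_power_diff_pcompose[OF assms, of "[:1, -1:]"] ..
  have p: "p > 0"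
    using assms prime_gt_0_nat by auto
  have comp: "pcompose [:1, -1:] ([:0, 1:] ^ p) = 1 - ([:0, 1:] ^ p :: int poly)"
    by (simp add: pcompose_pCons one_pCons)
  \<comment> \<open>\<open>(1 - X)^p\<close> and \<open>1 - X^p\<close> both vanish at
    \<open>1\<close>, so the Frobenius error has the factor \<open>X - 1\<close>; the cofactor is
    \<open>U\<close>.\<close>
  have "poly (of_nat p * Q) 1 = 0"
    unfolding Q[symmetric] comp using p by (simp add: power_0_left)
  then have "[:- 1, 1:] dvd Q"
    using p by (simp add: poly_eq_0_iff_dvd)
  then obtain U where "Q = [:- 1, 1:] * U" ..
  also have "\<dots> = - (U * [:1, -1:])"
    by simp
  finally have "[:1, -1:] ^ p = 1 - [:0, 1:] ^ p - of_nat p * U * [:1, -1:]"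
    using Q unfolding comp by (simp add: algebra_simps del: mult_pCons_left mult_pCons_right)
  then show ?thesis ..
qed

context
  fixes p :: nat and U :: "int poly"
  assumes prime_p: "prime p"
    and U: "[:1, -1:] ^ p = 1 - [:0, 1:] ^ p - of_nat p * U * [:1, -1:]"
begin

text \<open>Cancellation of \<open>1 - X\<close> in the equation for \<open>U\<close>. The geometric
  sum is kept visible because \<open>residue_sum\<close> turns it into evaluation at
  \<open>1\<close>.\<close>

lemma one_minus_X_power_prime_minus_1:
  "[:1, -1:] ^ (p - 1) = (\<Sum>k<p. [:0, 1:] ^ k) - of_nat p * U"
proof -
  have "1 - [:0, 1:] ^ p = [:1, -1:] * (\<Sum>k<p. [:0, 1:] ^ k :: int poly)"
    using one_diff_power_eq[of "[:0, 1:] :: int poly" p] by (simp add: one_pCons)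
  moreover have "[:1, -1:] * [:1, -1:] ^ (p - 1) = ([:1, -1:] ^ p :: int poly)"
    by (metis prime_gt_0_nat[OF prime_p] power_minus_mult mult.commute)
  ultimately have "[:1, -1:] * [:1, -1:] ^ (p - 1) =
      [:1, -1:] * ((\<Sum>k<p. [:0, 1:] ^ k) - of_nat p * U)"
    unfolding right_diff_distrib U by (simp only: mult_ac)
  then show ?thesis
    by (subst (asm) mult_cancel_left) simp
qed

text \<open>At \<open>1\<close> the geometric sum is \<open>p\<close> and the power of
  \<open>1 - X\<close> vanishes. The value \<open>1\<close> is what lets \<open>U(X ^ p)\<close> be
  replaced by \<open>1\<close> under \<open>residue_sum\<close>.\<close>

lemma poly_U_1: "poly U 1 = 1"
proof -
  have "poly ([:1, -1:] ^ (p - 1)) 1 = poly ((\<Sum>k<p. [:0, 1:] ^ k) - of_nat p * U) (1 :: int)"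
    by (simp only: one_minus_X_power_prime_minus_1)
  then have "int p * poly U 1 = int p"
    using prime_gt_1_nat[OF prime_p] by (simp add: poly_sum power_0_left)
  then show ?thesis
    using prime_gt_0_nat[OF prime_p] by simp
qed

text \<open>Each block of \<open>p - 1\<close> factors is traded for \<open>- p U\<close>, using one
  further factor \<open>1 - X\<close> to complete a \<open>p\<close>-th power; hence the factor kept
  on both sides. The term \<open>1 - X ^ p\<close> is killed, and \<open>h\<close> collects the
  factors \<open>U\<close>.\<close>

lemma residue_sum_one_minus_X_power:
  "residue_sum p r ([:1, -1:] * [:1, -1:] ^ ((p - 1) * q) * h) =
    (- int p) ^ q * residue_sum p r ([:1, -1:] * U ^ q * h)"
proof (induction q arbitrary: h)
  case (Suc q)
  let ?Y = "[:1, -1:] :: int poly"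
  have "?Y * ?Y ^ ((p - 1) * Suc q) * h = ?Y ^ p * (?Y ^ ((p - 1) * q) * h)"
  proof -
    have "?Y ^ p = ?Y * ?Y ^ (p - 1)"
      by (metis prime_gt_0_nat[OF prime_p] power_minus_mult mult.commute)
    then show ?thesis
      by (simp only: power_add mult_Suc_right mult.assoc mult.left_commute)
  qed
  also have "\<dots> = ?Y ^ ((p - 1) * q) * h - [:0, 1:] ^ p * (?Y ^ ((p - 1) * q) * h)
      - of_nat p * (?Y * ?Y ^ ((p - 1) * q) * (U * h))"
    unfolding U by (simp add: algebra_simps del: mult_pCons_left mult_pCons_right)
  finally show ?case
    by (simp only: residue_sum_diff residue_sum_X_power_prime_mult residue_sum_of_nat_mult Suc)
      (simp add: mult_ac del: mult_pCons_left mult_pCons_right)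
qed simp

text \<open>Dividing \<open>n - 1\<close> rather than \<open>n\<close> by \<open>p - 1\<close>
  leaves at least one factor \<open>1 - X\<close>, as the reduction requires, and its quotient is
  the very floor that normalizes the Fleck quotient.\<close>

lemma fleck_quotient_eq:
  assumes "n > 0"
  shows "fleck_quotient p n r =
    of_int (residue_sum p r ([:1, -1:] ^ Suc ((n - 1) mod (p - 1)) * U ^ ((n - 1) div (p - 1))))"
proof -
  let ?Y = "[:1, -1:] :: int poly"
  define q j where "q = (n - 1) div (p - 1)" and "j = (n - 1) mod (p - 1)"
  have n: "n = Suc ((p - 1) * q + j)"
    using assms by (simp add: q_def j_def)
  have "(int n - 1) div (int p - 1) = int q"
    using assms prime_gt_1_nat[OF prime_p]
    by (simp add: q_def zdiv_int of_nat_diff)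
  moreover have "fleck_sum p n r = (- int p) ^ q * residue_sum p r (?Y ^ Suc j * U ^ q)"
    unfolding fleck_sum_eq_residue_sum n
    using residue_sum_one_minus_X_power[of r q "?Y ^ j"]
    by (simp only: power_Suc power_add mult_ac)
  ultimately show ?thesis
    using assms prime_gt_0_nat[OF prime_p]
    unfolding fleck_quotient_def q_def[symmetric] j_def[symmetric]
    by (simp add: power_int_minus)
qed

text \<open>The geometric part of \<open>(1 - X) ^ (p - 1)\<close> contributes
  \<open>U(1) ^ l = 1\<close>. At \<open>k = 0\<close> the floor is \<open>-1\<close>, and the
  summand \<open>of_bool (n = 0)\<close> yields the same shape, so \<open>n = 0\<close> can be
  compared with larger multiples.\<close>

lemma fleck_quotient_multiple:
  assumes "n = (p - 1) * k"
  shows "fleck_quotient p n r = 1 - of_nat p * of_int (residue_sum p r (U ^ k))"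
proof (cases k)
  case 0
  have "fleck_sum p 0 r = residue_sum p r 1"
    by (simp add: fleck_sum_eq_residue_sum)
  moreover have "(- 1) div (int p - 1) = - 1"
    using prime_gt_1_nat[OF prime_p] by (subst div_eq_minus1) auto
  ultimately show ?thesis
    using 0 assms by (simp add: fleck_quotient_def)
next
  case (Suc l)
  have p: "p \<ge> 2"
    using prime_p by (rule prime_ge_2_nat)
  define s where "s = p - 2"
  have s: "p - 1 = Suc s"
    using p by (simp add: s_def)
  have n: "n - 1 = s + l * Suc s"
    unfolding assms s Suc by simp
  have "n > 0"
    using p by (simp add: assms Suc)
  moreover have "(n - 1) mod (p - 1) = s" "(n - 1) div (p - 1) = l"
    unfolding n s by (simp_all del: mult_Suc_right)
  ultimately have "fleck_quotient p n r = of_int (residue_sum p r ([:1, -1:] ^ (p - 1) * U ^ l))"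
    by (simp only: fleck_quotient_eq s)
  also have "[:1, -1:] ^ (p - 1) * U ^ l = (\<Sum>k<p. [:0, 1:] ^ k) * U ^ l - of_nat p * U ^ k"
    unfolding one_minus_X_power_prime_minus_1 by (simp add: Suc algebra_simps)
  also have "residue_sum p r \<dots> = 1 - int p * residue_sum p r (U ^ k)"
    by (simp only: residue_sum_diff residue_sum_power_sum_mult[OF prime_p] residue_sum_of_nat_mult)
      (simp add: poly_U_1)
  finally show ?thesis
    by simp
qed

text \<open>For \<open>p = 2\<close> the equation forces \<open>U = X\<close>, and
  \<open>X ^ 2\<close> acts as \<open>1\<close> under \<open>residue_sum\<close>. Every
  \<open>n\<close> is a multiple of \<open>p - 1 = 1\<close>, so the formula for multiples applies
  throughout.\<close>

lemma fleck_quotient_2: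
  assumes "p = 2"
  shows "fleck_quotient p (n + 2 * t) r = fleck_quotient p n r"
proof -
  have "(of_nat 2 * U) * [:1, -1:] = (of_nat 2 * [:0, 1:]) * [:1, -1:]"
  proof -
    have "of_nat 2 * U * [:1, -1:] = 1 - [:0, 1:] ^ 2 - [:1, -1:] ^ 2"
      using U unfolding assms by simp
    also have "\<dots> = (of_nat 2 * [:0, 1:]) * [:1, -1:]"
      by (simp add: power2_eq_square one_pCons of_nat_poly)
    finally show ?thesis .
  qed
  then have "of_nat 2 * U = of_nat 2 * [:0, 1:]"
    by (subst (asm) mult_cancel_right) simp
  then have "U = [:0, 1:]"
    by (subst (asm) mult_cancel_left) simp
  then have "residue_sum p r (U ^ (2 * t + k) * h) = residue_sum p r (U ^ k * h)" for k h
    unfolding power_add mult.assoc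
    by (simp only: residue_sum_X_power_mult)
      (intro residue_sum_cong, simp add: assms cong_iff_dvd_diff)
  from this[of n 1] show ?thesis
    using assms fleck_quotient_multiple[of "n + 2 * t" "n + 2 * t" r] fleck_quotient_multiple[of n n r]
    by (simp add: add.commute)
qed

section \<open>Powers of \<open>U\<close> with exponent divisible by \<open>p\<close>\<close>

context
  fixes V :: "int poly"
  assumes V: "U ^ p = pcompose U ([:0, 1:] ^ p) + of_nat p * V"
begin

text \<open>An exact identity: the factors \<open>U ^ p\<close> are exchanged one at a time, the
  terms already produced being absorbed into \<open>h\<close>.\<close>

lemma residue_sum_U_power_prime:
  "residue_sum p r (h * (U ^ p) ^ t) = residue_sum p r (h * (1 + of_nat p * V) ^ t)"
proof (induction t arbitrary: h)
  case (Suc t)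
  have "h * (U ^ p) ^ Suc t =
      pcompose U ([:0, 1:] ^ p) * (h * (U ^ p) ^ t) + (h * (of_nat p * V)) * (U ^ p) ^ t"
    by (subst power_Suc, subst (1) V) (simp add: algebra_simps)
  then have "residue_sum p r (h * (U ^ p) ^ Suc t) =
      residue_sum p r (h * (1 + of_nat p * V) ^ t + (h * (of_nat p * V)) * (1 + of_nat p * V) ^ t)"
    by (simp only: residue_sum_add residue_sum_pcompose_mult poly_U_1 Suc mult_1_left)
  then show ?case
    by (simp add: algebra_simps)
qed simp

lemma residue_sum_U_power_diff:
  assumes "odd p" "t = p ^ a * s"
  shows "\<exists>z. residue_sum p r (h * U ^ (p * t)) - residue_sum p r h =
    int (p * t) * residue_sum p r (h * V) + int (p ^ (a + 2)) * z"
proof -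
  obtain W where "(1 + of_nat p * V) ^ t =
      1 + of_nat p * of_nat t * V + of_nat (p ^ (a + 2)) * W"
    using one_plus_prime_mult_power[OF prime_p assms(1)] unfolding assms(2) by blast
  then have "h * (1 + of_nat p * V) ^ t =
      h + of_nat (p * t) * (h * V) + of_nat (p ^ (a + 2)) * (h * W)"
    by (simp only: distrib_left of_nat_mult mult_1_right) (simp only: mult_ac)
  then have "residue_sum p r (h * (1 + of_nat p * V) ^ t) = residue_sum p r h +
      int (p * t) * residue_sum p r (h * V) + int (p ^ (a + 2)) * residue_sum p r (h * W)"
    by (simp only: residue_sum_add residue_sum_of_nat_mult)
  then show ?thesis
    unfolding power_mult residue_sum_U_power_prime
    by (intro exI[of _ "residue_sum p r (h * W)"]) simp
qed

text \<open>Division of the increment by \<open>p * (p - 1) * t\<close> leaves a residue sum over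
  \<open>p - 1\<close>, and \<open>p - 1\<close> is \<open>-1\<close> modulo \<open>p\<close>: hence
  the minus sign. For \<open>n = 0\<close> the formula for multiples of \<open>p - 1\<close> carries
  an additional factor \<open>p\<close>, so the limit is \<open>0\<close>.\<close>

lemma fleck_quotient_diff_cong:
  assumes "odd p" "t > 0"
  shows "rat_cong p
    ((fleck_quotient p (n + p * (p - 1) * t) r - fleck_quotient p n r) /
      of_nat (p * (p - 1) * t))
    (if n = 0 then 0 else - of_int (residue_sum p r
      ([:1, -1:] ^ Suc ((n - 1) mod (p - 1)) * U ^ ((n - 1) div (p - 1)) * V)))"
proof -
  have p: "p > 2"
    using assms(1) prime_ge_2_nat[OF prime_p] by (cases "p = 2") auto
  have "\<exists>a s. t = p ^ a * s \<and> \<not> p dvd s"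
    using multiplicity_decompose'[of t p] p assms(2)
    by (metis less_numeral_extra(3) nat_dvd_1_iff_1 not_less_iff_gr_or_eq one_less_numeral_iff
        semiring_norm(76))
  then obtain s a where t: "t = p ^ a * s" and s: "\<not> p dvd s"
    by (elim exE conjE)
  have s0: "s > 0"
    using s by (cases "s = 0") simp_all
  have p1: "\<not> p dvd p - 1"
    using p by (intro nat_dvd_not_less) simp_all
  let ?d = "of_nat (p * (p - 1) * t) :: rat"
  have quotient: "of_int (int (p * t) * x + int (p ^ (a + 2)) * y) / ?d =
      (of_int x + of_nat p * of_int y / of_nat s) / of_nat (p - 1)" for x y
  proof -
    have "of_int (int (p * t) * x + int (p ^ (a + 2)) * y) =
        of_nat (p * t) * (of_int x + of_nat p * of_int y / of_nat s :: rat)"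
    proof -
      have "P * (c * S) * X + (c * P\<^sup>2) * Y = P * (c * S) * (X + P * Y / S)" if "S \<noteq> 0"
        for P c S X Y :: rat
        using that by (simp add: field_simps power2_eq_square)
      from this[of "of_nat s" "of_nat p" "of_nat p ^ a" "of_int x" "of_int y"] s0 show ?thesis
        by (simp add: t power2_eq_square mult_ac)
    qed
    moreover have "?d = of_nat (p * t) * of_nat (p - 1)"
      by (simp only: of_nat_mult mult_ac)
    moreover have "of_nat (p * t) \<noteq> (0 :: rat)"
      using p assms(2) by simp
    moreover have "A / B = C / D" if "A = T * C" "B = T * D" "T \<noteq> 0" for A B C D T :: rat
      using that by simp
    ultimately show ?thesis
      by blast
  qed
  have integral: "p_adic_integral p ((of_int x + of_int y / of_nat s) / of_nat (p - 1))" for x y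
    using prime_p p1 s by (intro p_adic_integral_divide_of_nat p_adic_integral_add) auto
  show ?thesis
  proof (cases "n = 0")
    case True
    obtain z where z: "residue_sum p r (1 * U ^ (p * t)) - residue_sum p r 1 =
        int (p * t) * residue_sum p r (1 * V) + int (p ^ (a + 2)) * z"
      using residue_sum_U_power_diff[OF assms(1) t] by blast
    have "n + p * (p - 1) * t = (p - 1) * (p * t)"
      using True by simp
    then have "fleck_quotient p (n + p * (p - 1) * t) r - fleck_quotient p n r =
        - of_nat p * of_int (residue_sum p r (1 * U ^ (p * t)) - residue_sum p r 1)"
      using True fleck_quotient_multiple[of _ "p * t" r] fleck_quotient_multiple[of 0 0 r]
      by (simp add: algebra_simps)
    also have "\<dots> / ?d =
        - of_nat p * (of_int (residue_sum p r (1 * V)) + of_nat p * of_int z / of_nat s) / of_nat (p - 1)"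
      unfolding z times_divide_eq_right[symmetric] quotient by (rule refl)
    also have "\<dots> = of_nat p * ((of_int (- residue_sum p r (1 * V)) +
        of_int (- int p * z) / of_nat s) / of_nat (p - 1))"
      by (simp add: algebra_simps diff_divide_distrib add_divide_distrib)
    finally show ?thesis
      unfolding if_P[OF True] by (simp only: rat_cong_prime_mult_0[OF prime_p integral])
  next
    case False
    define q j where "q = (n - 1) div (p - 1)" and "j = (n - 1) mod (p - 1)"
    define h where "h = [:1, -1:] ^ Suc j * U ^ q"
    obtain z where z: "residue_sum p r (h * U ^ (p * t)) - residue_sum p r h =
        int (p * t) * residue_sum p r (h * V) + int (p ^ (a + 2)) * z"
      using residue_sum_U_power_diff[OF assms(1) t] by blast
    have "n + p * (p - 1) * t - 1 = (n - 1) + p * t * (p - 1)"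
      using False by (simp add: mult_ac)
    then have div_mod: "(n + p * (p - 1) * t - 1) mod (p - 1) = j"
        "(n + p * (p - 1) * t - 1) div (p - 1) = q + p * t"
      unfolding q_def j_def using p by simp_all
    have "fleck_quotient p (n + p * (p - 1) * t) r =
        of_int (residue_sum p r ([:1, -1:] ^ Suc j * U ^ (q + p * t)))"
      by (subst fleck_quotient_eq) (use False in simp, simp only: div_mod)
    moreover have "fleck_quotient p n r = of_int (residue_sum p r h)"
      unfolding h_def q_def j_def by (rule fleck_quotient_eq) (use False in simp)
    ultimately have "fleck_quotient p (n + p * (p - 1) * t) r - fleck_quotient p n r =
        of_int (residue_sum p r (h * U ^ (p * t)) - residue_sum p r h)"
      by (simp only: h_def power_add mult.assoc of_int_diff)
    also have "\<dots> / ?d = (of_int (residue_sum p r (h * V)) + of_nat p * of_int z / of_nat s) / of_nat (p - 1)"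
      unfolding z by (rule quotient)
    also have "\<dots> = - of_int (residue_sum p r (h * V)) + of_nat p *
        ((of_int (residue_sum p r (h * V)) + of_int z / of_nat s) / of_nat (p - 1))"
    \<comment> \<open>This is \<open>1 / (p - 1) = -1 + p / (p - 1)\<close>, with \<open>D\<close>
      standing for \<open>p - 1\<close>.\<close>
    proof -
      have "(x + P * y) / D = - x + P * ((x + y) / D)" if "P = D + 1" "D \<noteq> 0" for x y P D :: rat
        using that by (simp add: field_simps)
      moreover have "of_nat p = of_nat (p - 1) + (1 :: rat)" "of_nat (p - 1) \<noteq> (0 :: rat)"
        using p by (simp_all add: of_nat_diff)
      ultimately show ?thesis
        unfolding times_divide_eq_right[symmetric] by blast
    qed
    finally have "(fleck_quotient p (n + p * (p - 1) * t) r - fleck_quotient p n r) / ?d =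
        - of_int (residue_sum p r (h * V)) + of_nat p *
        ((of_int (residue_sum p r (h * V)) + of_int z / of_nat s) / of_nat (p - 1))" .
    moreover have "rat_cong p (- of_int (residue_sum p r (h * V)) + of_nat p *
        ((of_int (residue_sum p r (h * V)) + of_int z / of_nat s) / of_nat (p - 1)))
        (- of_int (residue_sum p r (h * V)) + 0)"
      by (rule rat_cong_add[OF prime_p rat_cong_refl[OF prime_p]
          rat_cong_prime_mult_0[OF prime_p integral]])
    ultimately show ?thesis
      using False by (simp add: h_def q_def j_def)
  qed
qed

end

end

section \<open>Substituting \<open>e\<^sup>x\<close> into integer polynomials\<close>

text \<open>The ring homomorphism sending \<open>X\<close> to \<open>e^(cx)\<close>. A general
  \<open>c\<close> is kept because \<open>U(X ^ p)\<close> is sent to the series of \<open>U\<close>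
  at \<open>e^(px)\<close>.\<close>

definition exp_eval :: "rat \<Rightarrow> int poly \<Rightarrow> rat fps" where
  "exp_eval c f = poly (map_poly of_int f) (fps_exp c)"

lemma exp_eval_0 [simp]: "exp_eval c 0 = 0"
  by (simp add: exp_eval_def)

lemma exp_eval_pCons:
  "exp_eval c (pCons a f) = fps_const (of_int a) + fps_exp c * exp_eval c f"
  by (simp add: exp_eval_def map_poly_pCons fps_of_int)

lemma exp_eval_1 [simp]: "exp_eval c 1 = 1"
  by (simp add: one_pCons exp_eval_pCons)

lemma exp_eval_X: "exp_eval c [:0, 1:] = fps_exp c"
  by (simp add: exp_eval_pCons)

lemma exp_eval_add: "exp_eval c (f + g) = exp_eval c f + exp_eval c g"
proof -
  have "map_poly of_int (f + g) = map_poly of_int f + (map_poly of_int g :: rat fps poly)"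
    by (intro poly_eqI) (simp add: coeff_map_poly)
  then show ?thesis
    by (simp add: exp_eval_def)
qed

lemma exp_eval_smult: "exp_eval c (smult a f) = fps_const (of_int a) * exp_eval c f"
  by (induction f) (simp_all add: exp_eval_pCons algebra_simps)

lemma exp_eval_diff: "exp_eval c (f - g) = exp_eval c f - exp_eval c g"
proof -
  have "exp_eval c (f - g) = exp_eval c f + exp_eval c (smult (- 1) g)"
    unfolding exp_eval_add[symmetric] by simp
  then show ?thesis
    unfolding exp_eval_smult by (simp flip: fps_const_neg)
qed

lemma exp_eval_mult: "exp_eval c (f * g) = exp_eval c f * exp_eval c g"
  by (induction f) (simp_all add: exp_eval_add exp_eval_smult exp_eval_pCons algebra_simps)

lemma exp_eval_power: "exp_eval c (f ^ k) = exp_eval c f ^ k"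
  by (induction k) (simp_all add: exp_eval_mult)

lemma exp_eval_of_nat: "exp_eval c (of_nat a) = fps_const (of_nat a)"
  by (simp add: of_nat_poly exp_eval_pCons)

lemma exp_eval_pcompose_X_power:
  "exp_eval c (pcompose f ([:0, 1:] ^ k)) = exp_eval (of_nat k * c) f"
  by (induction f)
    (simp_all add: pcompose_pCons exp_eval_add exp_eval_mult exp_eval_power exp_eval_X
      exp_eval_pCons fps_exp_power_mult)

text \<open>Passing from \<open>e^x\<close> to \<open>e^(cx)\<close> rescales \<open>x\<close>. With
  \<open>c = p\<close> this puts the factor \<open>p^k\<close> on coefficient \<open>k\<close> of
  \<open>U(e^(px))\<close>.\<close>

lemma exp_eval_nth: "fps_nth (exp_eval c f) k = c ^ k * fps_nth (exp_eval 1 f) k"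
proof (induction f arbitrary: k)
  case (pCons a f)
  have "fps_nth (fps_exp c * exp_eval c f) k = c ^ k * fps_nth (fps_exp 1 * exp_eval 1 f) k"
    unfolding fps_mult_nth sum_distrib_left
  proof (intro sum.cong refl)
    fix i assume "i \<in> {0..k}"
    then have "c ^ k = c ^ i * c ^ (k - i)"
      by (simp flip: power_add)
    then show "fps_nth (fps_exp c) i * fps_nth (exp_eval c f) (k - i) =
        c ^ k * (fps_nth (fps_exp 1) i * fps_nth (exp_eval 1 f) (k - i))"
      unfolding pCons.IH[of "k - i"] by simp
  qed
  then show ?case
    by (simp only: exp_eval_pCons fps_add_nth distrib_left) simp
qed simp

lemma fps_integral_exp:
  assumes "prime p"
  shows "fps_integral p p (fps_exp (of_int c))"
  unfolding fps_integral_def fps_exp_nth of_nat_fact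
  using assms by (intro allI impI p_adic_integral_divide_fact p_adic_integral_power) auto

lemma fps_integral_exp_eval:
  assumes "prime p"
  shows "fps_integral p p (exp_eval 1 f)"
proof (induction f)
  case (pCons a f)
  have "fps_integral p p (fps_exp 1 * exp_eval 1 f)"
    using fps_integral_mult[OF assms fps_integral_exp[OF assms, of 1] pCons.IH] by simp
  then show ?case
    using assms by (auto simp: fps_integral_def exp_eval_pCons intro!: p_adic_integral_intros)
qed (use assms in \<open>auto simp: fps_integral_def intro: p_adic_integral_0\<close>)

lemma rat_cong_divide_fact:
  assumes "prime p" "k < p" "[x = y * fact k] (mod int p)"
  shows "rat_cong p (of_int x / fact k) (of_int y)"
proof -
  obtain c where "x - y * fact k = int p * c"
    using assms(3) by (auto simp: cong_iff_dvd_diff)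
  then have "of_int x - of_int y * fact k = (of_nat p * of_int c :: rat)"
    by (metis of_int_diff of_int_fact of_int_mult of_int_of_nat_eq)
  then have "of_int x / fact k - of_int y = of_nat p * (of_int c / fact k :: rat)"
    by (simp add: field_simps)
  then have "(of_int x / fact k - of_int y) / of_nat p = (of_int c / fact k :: rat)"
    using prime_gt_0_nat[OF assms(1)] by simp
  then show ?thesis
    unfolding rat_cong_def using assms by (simp add: p_adic_integral_divide_fact)
qed

text \<open>By the theorems of Fermat and Wilson, \<open>x ^ (p - 1) / (p - 1)!\<close> is congruent to
  \<open>0\<close> or \<open>-1\<close>, so the coefficient of \<open>x ^ (p - 1)\<close> detects a residue
  class modulo \<open>p\<close>.\<close>

lemma residue_sum_rat_cong:
  assumes "prime p"
  shows "rat_cong p (fps_nth (fps_exp (- of_int r) * exp_eval 1 f) (p - 1))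
    (of_int (residue_sum p r f - poly f 1))"
proof (induction f arbitrary: r)
  case 0
  then show ?case
    by (simp add: rat_cong_refl[OF assms])
next
  case (pCons a f)
  have p: "p - 1 < p"
    using prime_gt_0_nat[OF assms] by simp
  have "[(- r) ^ (p - 1) = of_bool (\<not> int p dvd r) * 1] (mod int p)"
    using fermat_int[OF assms, of "- r"] by simp
  moreover have "[(of_bool ([0 = r] (mod int p)) - 1) * fact (p - 1) =
      (of_bool ([0 = r] (mod int p)) - 1) * - 1] (mod int p)"
    by (intro cong_mult cong_refl wilson_theorem assms)
  moreover have "(of_bool ([0 = r] (mod int p)) - 1) * - 1 = (of_bool (\<not> int p dvd r) :: int)"
    by (simp add: cong_iff_dvd_diff)
  ultimately have "[(- r) ^ (p - 1) = (of_bool ([0 = r] (mod int p)) - 1) * fact (p - 1)] (mod int p)"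
    by (metis cong_sym cong_trans mult_1_right)
  then have "rat_cong p (of_int ((- r) ^ (p - 1)) / fact (p - 1))
      (of_int (of_bool ([0 = r] (mod int p)) - 1))"
    by (rule rat_cong_divide_fact[OF assms p])
  then have "rat_cong p (of_int a * (of_int ((- r) ^ (p - 1)) / fact (p - 1)))
      (of_int a * of_int (of_bool ([0 = r] (mod int p)) - 1))"
    using assms by (intro rat_cong_mult_left) auto
  from rat_cong_add[OF assms this pCons.IH[of "r - 1"]]
  have "rat_cong p (of_int a * (of_int ((- r) ^ (p - 1)) / fact (p - 1)) +
        fps_nth (fps_exp (- of_int (r - 1)) * exp_eval 1 f) (p - 1))
      (of_int (residue_sum p r (pCons a f) - poly (pCons a f) 1))"
    by (simp add: residue_sum_pCons algebra_simps)
  \<comment> \<open>The factor \<open>e^x\<close> coming from \<open>X\<close> turns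
    \<open>r\<close> into \<open>r - 1\<close>, the same shift as in
    \<open>residue_sum_pCons\<close>.\<close>
  moreover have "fps_exp (- of_int r) * exp_eval 1 (pCons a f) =
      fps_const (of_int a) * fps_exp (- of_int r) + fps_exp (- of_int (r - 1)) * exp_eval 1 f"
  proof -
    have "fps_exp (- of_int r) * fps_exp 1 = (fps_exp (- of_int (r - 1)) :: rat fps)"
      by (simp flip: fps_exp_add_mult)
    then show ?thesis
      unfolding exp_eval_pCons distrib_left by (simp only: mult.assoc[symmetric]) (simp only: mult_ac)
  qed
  ultimately show ?case
    by (simp add: of_nat_fact)
qed

section \<open>The generating function of the Bernoulli numbers\<close>

text \<open>The series \<open>(e^x - 1)/x\<close>; its inverse \<open>bernoulli_fps\<close> is
  \<open>x/(e^x - 1)\<close>.\<close>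

definition exp_quotient_fps :: "rat fps" where
  "exp_quotient_fps = Abs_fps (\<lambda>k. 1 / fact (Suc k))"

definition bernoulli_fps :: "rat fps" where
  "bernoulli_fps = inverse exp_quotient_fps"

text \<open>This is \<open>log((e^x - 1)/x) - x/2\<close>: the coefficients are
  \<open>B_k/(k k!)\<close> for \<open>k > 1\<close>, and the linear term is left out.\<close>

definition bernoulli_log_fps :: "rat fps" where
  "bernoulli_log_fps = Abs_fps (\<lambda>k. if k \<le> 1 then 0 else fps_nth bernoulli_fps k / of_nat k)"

lemma exp_quotient_fps_nth_0 [simp]: "fps_nth exp_quotient_fps 0 = 1"
  by (simp add: exp_quotient_fps_def)

lemma bernoulli_fps_nth_0 [simp]: "fps_nth bernoulli_fps 0 = 1"
  by (simp add: bernoulli_fps_def)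

lemma exp_quotient_mult_bernoulli_fps: "exp_quotient_fps * bernoulli_fps = 1"
  unfolding bernoulli_fps_def by (simp add: inverse_mult_eq_1')

lemma fps_exp_minus_1: "fps_exp 1 - 1 = fps_X * exp_quotient_fps"
proof (rule fps_ext)
  fix k show "fps_nth (fps_exp 1 - 1) k = fps_nth (fps_X * exp_quotient_fps) k"
    by (cases k) (simp_all add: exp_quotient_fps_def of_nat_fact algebra_simps)
qed

lemma bernoulli_poly_order_eq:
  "bernoulli_poly_order m k t = fact k * fps_nth (bernoulli_fps ^ m * fps_exp t) k"
proof -
  have "exp_quotient_fps ^ m * bernoulli_fps ^ m = 1"
    by (simp add: exp_quotient_mult_bernoulli_fps flip: power_mult_distrib)
  then have "fps_X ^ m * fps_exp t =
      (exp_quotient_fps ^ m * bernoulli_fps ^ m) * (fps_X ^ m * fps_exp t)"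
    by simp
  also have "\<dots> = (bernoulli_fps ^ m * fps_exp t) * (fps_exp 1 - 1) ^ m"
    unfolding fps_exp_minus_1 power_mult_distrib by (simp only: mult_ac)
  finally have "fps_X ^ m * fps_exp t = (bernoulli_fps ^ m * fps_exp t) * (fps_exp 1 - 1) ^ m" .
  moreover have "(fps_exp 1 - 1 :: rat fps) ^ m \<noteq> 0"
    by simp
  ultimately show ?thesis
    unfolding bernoulli_poly_order_def by (metis nonzero_mult_div_cancel_right)
qed

lemma bernoulli_number_eq: "bernoulli_number k = fact k * fps_nth bernoulli_fps k"
  by (simp add: bernoulli_number_def bernoulli_poly_order_eq)

text \<open>A binomial convolution is a product of exponential generating functions; the range
  \<open>1 < k\<close> reflects the vanishing of \<open>bernoulli_log_fps\<close> in degrees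
  \<open>0\<close> and \<open>1\<close>.\<close>

lemma bernoulli_sum_eq:
  "(\<Sum>k\<in>{1<..N}. of_nat (N choose k) * (bernoulli_number k / of_nat k) *
      bernoulli_poly_order m (N - k) t) =
    fact N * fps_nth (bernoulli_log_fps * (bernoulli_fps ^ m * fps_exp t)) N"
proof -
  have "fact N * fps_nth (bernoulli_log_fps * (bernoulli_fps ^ m * fps_exp t)) N =
      (\<Sum>k\<in>{0..N}. fact N * (fps_nth bernoulli_log_fps k *
        fps_nth (bernoulli_fps ^ m * fps_exp t) (N - k)))"
    by (simp add: fps_mult_nth[of bernoulli_log_fps] sum_distrib_left)
  also have "\<dots> = (\<Sum>k\<in>{1<..N}. fact N * (fps_nth bernoulli_log_fps k *
        fps_nth (bernoulli_fps ^ m * fps_exp t) (N - k)))"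
    by (intro sum.mono_neutral_right) (auto simp: bernoulli_log_fps_def)
  also have "\<dots> = (\<Sum>k\<in>{1<..N}. of_nat (N choose k) * (bernoulli_number k / of_nat k) *
      bernoulli_poly_order m (N - k) t)"
  proof (intro sum.cong refl)
    fix k assume k: "k \<in> {1<..N}"
    then have "fact N = fact k * fact (N - k) * (of_nat (N choose k) :: rat)"
      using binomial_fact_lemma[of k N] by (metis greaterThanAtMost_iff of_nat_fact of_nat_mult)
    then show "fact N * (fps_nth bernoulli_log_fps k *
          fps_nth (bernoulli_fps ^ m * fps_exp t) (N - k)) =
        of_nat (N choose k) * (bernoulli_number k / of_nat k) * bernoulli_poly_order m (N - k) t"
      using k by (simp add: bernoulli_number_eq bernoulli_poly_order_eq bernoulli_log_fps_def)
  qed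
  finally show ?thesis ..
qed

text \<open>The logarithmic derivative of \<open>b = x/(e^x - 1)\<close>. Since
  \<open>e^x = 1 + x g\<close> is its own derivative and \<open>g b = 1\<close>, one finds
  \<open>x b'/b = 1 - b - x\<close>; taking \<open>k > 0\<close> stays clear of the term
  \<open>- x\<close>.\<close>

lemma exp_quotient_mult_deriv_bernoulli_nth:
  assumes "k > 0"
  shows "fps_nth (exp_quotient_fps * fps_deriv bernoulli_fps) k = - fps_nth bernoulli_fps (Suc k)"
proof -
  let ?g = exp_quotient_fps and ?b = bernoulli_fps
  have E: "fps_exp 1 = 1 + fps_X * ?g"
    using fps_exp_minus_1 by (simp add: algebra_simps)
  have "fps_deriv (1 + fps_X * ?g) = 1 + fps_X * ?g"
    unfolding E[symmetric] by simp
  then have "fps_X * fps_deriv ?g = 1 + fps_X * ?g - ?g"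
    by (simp add: algebra_simps)
  moreover have "fps_deriv (?g * ?b) = 0"
    by (simp add: exp_quotient_mult_bernoulli_fps)
  then have "?g * fps_deriv ?b = - (fps_deriv ?g * ?b)"
    by (simp add: eq_neg_iff_add_eq_0)
  ultimately have "fps_X * (?g * fps_deriv ?b) = - ((1 + fps_X * ?g - ?g) * ?b)"
    by (metis mult.assoc mult_minus_right)
  also have "\<dots> = - ?b - fps_X * (?g * ?b) + ?g * ?b"
    by (simp add: algebra_simps)
  also have "\<dots> = 1 - ?b - fps_X"
    unfolding exp_quotient_mult_bernoulli_fps by simp
  finally have "fps_nth (fps_X * (?g * fps_deriv ?b)) (Suc k) = fps_nth (1 - ?b - fps_X) (Suc k)"
    by simp
  then show ?thesis
    using assms by simp
qed

section \<open>The Bernoulli series modulo \<open>p\<close>\<close>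

lemma fps_integral_exp_quotient:
  assumes "prime p"
  shows "fps_integral p (p - 1) exp_quotient_fps"
  unfolding fps_integral_def exp_quotient_fps_def fps_nth_Abs_fps
  using assms by (intro allI impI p_adic_integral_divide_fact p_adic_integral_1) auto

lemma fps_integral_bernoulli:
  assumes "prime p"
  shows "fps_integral p (p - 1) bernoulli_fps"
  unfolding bernoulli_fps_def
  using assms by (intro fps_integral_inverse fps_integral_exp_quotient) auto

lemma fps_integral_bernoulli_log:
  assumes "prime p"
  shows "fps_integral p (p - 1) bernoulli_log_fps"
  unfolding fps_integral_def
proof (intro allI impI)
  fix k assume k: "k < p - 1"
  then have "p_adic_integral p (fps_nth bernoulli_fps k)"
    using fps_integral_bernoulli[OF assms] by (simp add: fps_integral_def)
  then show "p_adic_integral p (fps_nth bernoulli_log_fps k)"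
    using k assms unfolding bernoulli_log_fps_def
    by (auto intro!: p_adic_integral_divide_of_nat p_adic_integral_0 dest: dvd_imp_le)
qed

lemma fps_cong_bernoulli_power_mod:
  assumes "prime p"
  shows "fps_cong p (p - 1) (bernoulli_fps ^ a) (bernoulli_fps ^ (a mod p))"
proof -
  let ?b = bernoulli_fps
  have "fps_cong p (p - 1) ((?b ^ p) ^ (a div p)) (1 ^ (a div p))"
    using assms
    by (intro fps_cong_power fps_integral_power fps_integral_1 fps_cong_power_prime_1
        fps_integral_bernoulli) auto
  then have "fps_cong p (p - 1) ((?b ^ p) ^ (a div p) * ?b ^ (a mod p)) (1 * ?b ^ (a mod p))"
    using assms
    by (intro fps_cong_mult fps_integral_power fps_integral_bernoulli fps_cong_refl) auto
  moreover have "?b ^ a = (?b ^ p) ^ (a div p) * ?b ^ (a mod p)"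
    by (simp flip: power_mult power_add)
  ultimately show ?thesis
    by simp
qed

text \<open>As \<open>b^p\<close> is congruent to \<open>1\<close>, the inverse of \<open>b\<close>
  is congruent to \<open>b^(p-1)\<close>. Powers of \<open>(e^x - 1)/x\<close> thus become
  nonnegative powers of \<open>b\<close>, that is, orders of Bernoulli polynomials.\<close>

lemma fps_cong_exp_quotient_bernoulli_power:
  assumes "prime p"
  shows "fps_cong p (p - 1) (bernoulli_fps ^ (p - 1)) exp_quotient_fps"
proof -
  let ?g = exp_quotient_fps and ?b = bernoulli_fps
  have "fps_cong p (p - 1) (?b ^ p * ?g) (1 * ?g)"
    using assms
    by (intro fps_cong_mult fps_integral_power fps_integral_exp_quotient fps_cong_power_prime_1
        fps_integral_bernoulli fps_cong_refl) auto
  moreover have "?b ^ p * ?g = ?b ^ (p - 1) * (?g * ?b)"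
    using power_minus_mult[of p ?b] prime_gt_0_nat[OF assms] by (metis mult.assoc mult.commute)
  ultimately show ?thesis
    by (simp add: exp_quotient_mult_bernoulli_fps)
qed

section \<open>The main congruence\<close>

context
  fixes p :: nat and U V :: "int poly"
  assumes prime_p: "prime p"
    and U: "[:1, -1:] ^ p = 1 - [:0, 1:] ^ p - of_nat p * U * [:1, -1:]"
    and V: "U ^ p = pcompose U ([:0, 1:] ^ p) + of_nat p * V"
begin

lemma exp_eval_one_minus_X: "exp_eval 1 [:1, -1:] = - (fps_X * exp_quotient_fps)"
  unfolding fps_exp_minus_1[symmetric]
  by (simp add: exp_eval_pCons flip: fps_const_neg)

text \<open>Setting \<open>X = e^x\<close> in the equation for \<open>U\<close>, the left side
  starts at \<open>x^p\<close>. Below that degree the equation says exactly that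
  \<open>U(e^x) (e^x - 1)/x\<close> equals \<open>(e^(px) - 1)/(px)\<close>.\<close>

lemma exp_eval_U_mult_nth:
  assumes "k < p - 1"
  shows "fps_nth (exp_eval 1 U * exp_quotient_fps) k = of_nat p ^ k / fact (Suc k)"
proof -
  let ?g = exp_quotient_fps
  have "exp_eval 1 ([:1, -1:] ^ p) = exp_eval 1 (1 - [:0, 1:] ^ p - of_nat p * (U * [:1, -1:]))"
    by (simp only: U mult.assoc)
  then have "(- (fps_X * ?g)) ^ p =
      1 - fps_exp (of_nat p) - fps_const (of_nat p) * (exp_eval 1 U * (- (fps_X * ?g)))"
    by (simp only: exp_eval_power exp_eval_diff exp_eval_mult exp_eval_of_nat exp_eval_1
        exp_eval_one_minus_X exp_eval_X fps_exp_power_mult mult_1_right)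
  moreover have "(- (fps_X * ?g)) ^ p = fps_X ^ p * (- ?g) ^ p"
    by (simp flip: power_mult_distrib)
  moreover have "fps_const (of_nat p) * (exp_eval 1 U * (- (fps_X * ?g))) =
      - (fps_const (of_nat p) * (fps_X * (exp_eval 1 U * ?g)))"
    by (simp add: mult_ac)
  ultimately have "fps_nth (fps_X ^ p * (- ?g) ^ p) (Suc k) = fps_nth (1 - fps_exp (of_nat p) +
      fps_const (of_nat p) * (fps_X * (exp_eval 1 U * ?g))) (Suc k)"
    by (simp only: diff_minus_eq_add)
  moreover have "Suc k < p"
    using assms by simp
  ultimately have "0 = - (of_nat p ^ Suc k / fact (Suc k)) + of_nat p * fps_nth (exp_eval 1 U * ?g) k"
    by (simp add: fps_X_power_mult_nth fps_mult_left_const_nth of_nat_fact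
        del: fact_Suc power_Suc)
  then show ?thesis
    using prime_gt_0_nat[OF prime_p] by (simp add: field_simps del: fact_Suc)
qed

lemma exp_eval_U_nth_0: "fps_nth (exp_eval 1 U) 0 = 1"
  using exp_eval_U_mult_nth[of 0] prime_gt_1_nat[OF prime_p] by simp

lemma fps_cong_exp_eval_U: "fps_cong p (p - 1) (exp_eval 1 U) bernoulli_fps"
proof -
  let ?u = "exp_eval 1 U" and ?g = exp_quotient_fps
  have integral_u: "fps_integral p (p - 1) ?u"
    using fps_integral_exp_eval[OF prime_p] by (rule fps_integral_mono) simp
  have "fps_cong p (p - 1) (?u * ?g) 1"
    unfolding fps_cong_def
  proof (intro allI impI)
    fix k assume k: "k < p - 1"
    show "rat_cong p (fps_nth (?u * ?g) k) (fps_nth 1 k)"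
    proof (cases k)
      case 0
      then show ?thesis
        using exp_eval_U_mult_nth[OF k] rat_cong_refl[OF prime_p] by simp
    next
      case (Suc l)
      have "p_adic_integral p (of_nat p ^ l / fact (Suc k))"
        using k prime_p
        by (intro p_adic_integral_divide_fact p_adic_integral_power p_adic_integral_of_nat) auto
      from rat_cong_prime_mult_0[OF prime_p this] show ?thesis
        unfolding exp_eval_U_mult_nth[OF k] by (simp add: Suc del: fact_Suc)
    qed
  qed
  then have "fps_cong p (p - 1) (?u * ?g * bernoulli_fps) (1 * bernoulli_fps)"
    using prime_p integral_u
    by (intro fps_cong_mult fps_integral_mult fps_integral_exp_quotient fps_integral_bernoulli
        fps_cong_refl) auto
  then show ?thesis
    by (simp add: mult.assoc exp_quotient_mult_bernoulli_fps)
qed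

text \<open>Coefficient \<open>k\<close> of \<open>U(e^x)^p\<close> is \<open>p/k\<close> times that
  of \<open>u^(p-1) u'\<close> in degree \<open>k - 1\<close>. After removing one \<open>p\<close>,
  \<open>u^(p-1)\<close> is replaced by the inverse of \<open>b\<close>, so \<open>b'/b\<close>
  appears and its coefficients are Bernoulli numbers.\<close>

lemma fps_cong_exp_eval_V: "fps_cong p (p - 1) (exp_eval 1 V) (- bernoulli_log_fps)"
  unfolding fps_cong_def
proof (intro allI impI)
  fix k assume k: "k < p - 1"
  let ?u = "exp_eval 1 U" and ?v = "exp_eval 1 V" and ?b = bernoulli_fps
  let ?w = "?u ^ (p - 1) * fps_deriv ?u"
  have p: "p \<noteq> 0"
    using prime_gt_0_nat[OF prime_p] by simp
  have "exp_eval 1 (U ^ p) = exp_eval 1 (pcompose U ([:0, 1:] ^ p) + of_nat p * V)"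
    by (simp only: V)
  then have "?u ^ p = exp_eval (of_nat p) U + fps_const (of_nat p) * ?v"
    by (simp only: exp_eval_power exp_eval_add exp_eval_pcompose_X_power exp_eval_mult exp_eval_of_nat
        mult_1_right)
  then have "fps_nth (?u ^ p) k = fps_nth (exp_eval (of_nat p) U + fps_const (of_nat p) * ?v) k"
    by simp
  then have u: "fps_nth (?u ^ p) k = of_nat p ^ k * fps_nth ?u k + of_nat p * fps_nth ?v k"
    by (simp only: fps_add_nth fps_mult_left_const_nth exp_eval_nth[of "of_nat p"])
  have v: "fps_nth ?v k = fps_nth ?w (k - 1) / of_nat k - of_nat p ^ (k - 1) * fps_nth ?u k"
    if "k > 0"
  proof -
    have "of_nat p ^ k = (of_nat p * of_nat p ^ (k - 1) :: rat)"
      using that by (cases k) simp_all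
    then have "of_nat p * (fps_nth ?w (k - 1) / of_nat k) =
        of_nat p * (of_nat p ^ (k - 1) * fps_nth ?u k + fps_nth ?v k)"
      using u unfolding fps_power_prime_nth[OF prime_p that]
      by (simp only: distrib_left mult.assoc times_divide_eq_right)
    then have "fps_nth ?w (k - 1) / of_nat k = of_nat p ^ (k - 1) * fps_nth ?u k + fps_nth ?v k"
      by (subst (asm) mult_left_cancel) (simp_all only: of_nat_eq_0_iff p not_False_eq_True)
    then show ?thesis
      by (simp only: add_diff_cancel_left')
  qed
  consider "k = 0" | "k = 1" | "k \<ge> 2"
    by linarith
  then show "rat_cong p (fps_nth ?v k) (fps_nth (- bernoulli_log_fps) k)"
  proof cases
    case 1
    then have "fps_nth ?v k = 0"
      using u p exp_eval_U_nth_0 by (simp add: fps_power_zeroth)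
    then show ?thesis
      using 1 rat_cong_refl[OF prime_p] by (simp add: bernoulli_log_fps_def)
  next
    \<comment> \<open>In degree \<open>1\<close> the contribution \<open>p^(k-1) u_k\<close> of
      \<open>U(e^(px))\<close> is not small: it equals the linear logarithmic term and cancels
      it.\<close>
    case 2
    then have "fps_nth ?v k = 0"
      using v exp_eval_U_nth_0 by (simp add: fps_power_zeroth)
    then show ?thesis
      using 2 rat_cong_refl[OF prime_p] by (simp add: bernoulli_log_fps_def)
  next
    case 3
    have integral_u: "fps_integral p N ?u" if "N \<le> p" for N
      using fps_integral_exp_eval[OF prime_p] that by (rule fps_integral_mono)
    have "fps_cong p (p - 1) (?u ^ (p - 1)) (?b ^ (p - 1))"
      by (intro fps_cong_power prime_p integral_u fps_integral_bernoulli fps_cong_exp_eval_U) simp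
    then have "fps_cong p (p - 1) (?u ^ (p - 1)) exp_quotient_fps"
      using fps_cong_exp_quotient_bernoulli_power[OF prime_p] fps_cong_trans[OF prime_p] by blast
    then have "fps_cong p k (?u ^ (p - 1)) exp_quotient_fps"
      by (rule fps_cong_mono) (use k in simp)
    moreover have "fps_cong p k (fps_deriv ?u) (fps_deriv ?b)"
      by (intro fps_cong_deriv prime_p fps_cong_mono[OF fps_cong_exp_eval_U]) (use k in simp)
    moreover have "fps_integral p k (fps_deriv ?b)"
      by (intro fps_integral_deriv prime_p fps_integral_mono[OF fps_integral_bernoulli])
        (use k in simp)
    ultimately have "fps_cong p k ?w (exp_quotient_fps * fps_deriv ?b)"
      using k by (intro fps_cong_mult prime_p fps_integral_power integral_u) simp_all
    then have "rat_cong p (fps_nth ?w (k - 1)) (fps_nth (exp_quotient_fps * fps_deriv ?b) (k - 1))"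
      using 3 by (simp add: fps_cong_def)
    moreover have "p_adic_integral p (1 / of_nat k)"
      using 3 k prime_p
      by (intro p_adic_integral_divide_of_nat p_adic_integral_1) (auto dest: dvd_imp_le)
    ultimately have "rat_cong p (1 / of_nat k * fps_nth ?w (k - 1))
        (1 / of_nat k * fps_nth (exp_quotient_fps * fps_deriv ?b) (k - 1))"
      by (intro rat_cong_mult_left prime_p)
    then have w: "rat_cong p (fps_nth ?w (k - 1) / of_nat k) (fps_nth (- bernoulli_log_fps) k)"
      using 3 exp_quotient_mult_deriv_bernoulli_nth[of "k - 1"]
      by (simp add: bernoulli_log_fps_def)
    have "p_adic_integral p (of_nat p ^ (k - 2) * fps_nth ?u k)"
      using integral_u[of p] k prime_p
      by (intro p_adic_integral_mult p_adic_integral_power p_adic_integral_of_nat)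
        (auto simp: fps_integral_def)
    \<comment> \<open>Since \<open>k >= 2\<close>, a factor \<open>p\<close> survives the division
      by \<open>p\<close>, so \<open>U(e^(px))\<close> contributes nothing.\<close>
    moreover have "(of_nat p :: rat) ^ (k - 1) = of_nat p * of_nat p ^ (k - 2)"
      using 3 by (simp add: numeral_2_eq_2 Suc_diff_Suc flip: power_Suc)
    ultimately have "rat_cong p (of_nat p ^ (k - 1) * fps_nth ?u k) 0"
      using rat_cong_prime_mult_0[OF prime_p] by (simp add: mult.assoc)
    from rat_cong_diff[OF prime_p w this] show ?thesis
      using 3 v by simp
  qed
qed

text \<open>Under \<open>X = e^x\<close> the power \<open>(1 - X)^d\<close> supplies the sign and
  lowers the degree to \<open>p - 1 - d\<close>, which \<open>d > 0\<close> keeps inside the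
  precision. The factor \<open>g^d u^q\<close> becomes \<open>b^(q + (p-1) d)\<close>.\<close>

lemma residue_sum_bernoulli_cong:
  assumes "0 < d" "d \<le> p - 1"
  shows "rat_cong p
    (- of_int (residue_sum p r ([:1, -1:] ^ d * U ^ q * V)))
    ((- 1) ^ d * fps_nth (bernoulli_log_fps *
      (bernoulli_fps ^ ((q + (p - 1) * d) mod p) * fps_exp (- of_int r))) (p - 1 - d))"
proof -
  let ?g = exp_quotient_fps and ?u = "exp_eval 1 U" and ?v = "exp_eval 1 V"
    and ?b = bernoulli_fps and ?E = "fps_exp (- of_int r :: rat)"
  let ?M = "p - 1" and ?s = "(q + (p - 1) * d) mod p"
  define f where "f = [:1, -1:] ^ d * U ^ q * V"
  have integral: "fps_integral p ?M ?u" "fps_integral p ?M ?v" "fps_integral p ?M ?E"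
    using fps_integral_exp[OF prime_p, of "- r"]
    by (auto intro!: fps_integral_mono[OF fps_integral_exp_eval[OF prime_p]]
        elim!: fps_integral_mono)
  note integral = integral fps_integral_exp_quotient[OF prime_p] fps_integral_bernoulli[OF prime_p]
    fps_integral_bernoulli_log[OF prime_p]
  have neg: "fps_integral p ?M (- bernoulli_log_fps)"
    using integral(6) by (auto simp: fps_integral_def intro: p_adic_integral_uminus[OF prime_p])
  have "fps_cong p ?M (?g ^ d) ((?b ^ ?M) ^ d)"
    by (intro fps_cong_power prime_p integral fps_integral_power
        fps_cong_sym[OF prime_p fps_cong_exp_quotient_bernoulli_power])
  moreover have "fps_cong p ?M (?u ^ q) (?b ^ q)"
    by (intro fps_cong_power prime_p integral fps_cong_exp_eval_U)
  ultimately have "fps_cong p ?M (?g ^ d * ?u ^ q) ((?b ^ ?M) ^ d * ?b ^ q)"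
    by (intro fps_cong_mult prime_p integral fps_integral_power)
  also have "(?b ^ ?M) ^ d * ?b ^ q = ?b ^ (q + ?M * d)"
    by (simp add: power_add mult.commute flip: power_mult)
  finally have "fps_cong p ?M (?g ^ d * ?u ^ q) (?b ^ ?s)"
    using fps_cong_bernoulli_power_mod[OF prime_p] fps_cong_trans[OF prime_p] by blast
  then have "fps_cong p ?M (?E * (?g ^ d * ?u ^ q * ?v)) (?E * (?b ^ ?s * - bernoulli_log_fps))"
    by (intro fps_cong_mult prime_p integral neg fps_integral_power fps_integral_mult
        fps_cong_exp_eval_V fps_cong_refl)
  then have 1: "rat_cong p (fps_nth (?E * (?g ^ d * ?u ^ q * ?v)) (?M - d))
      (fps_nth (?E * (?b ^ ?s * - bernoulli_log_fps)) (?M - d))"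
    using assms by (simp add: fps_cong_def)
  have "?E * exp_eval 1 f = fps_const ((- 1) ^ d) * (fps_X ^ d * (?E * (?g ^ d * ?u ^ q * ?v)))"
  proof -
    have "(- (fps_X * ?g)) ^ d = fps_const ((- 1) ^ d) * (fps_X ^ d * ?g ^ d)"
      by (simp add: power_minus[of "fps_X * ?g"] power_mult_distrib fps_const_power[symmetric]
          fps_const_neg[symmetric] del: fps_const_neg fps_const_power)
    then show ?thesis
      unfolding f_def exp_eval_mult exp_eval_power exp_eval_one_minus_X by (simp only: mult_ac)
  qed
  then have "fps_nth (?E * exp_eval 1 f) ?M =
      (- 1) ^ d * fps_nth (?E * (?g ^ d * ?u ^ q * ?v)) (?M - d)"
    using assms by (simp only: fps_mult_left_const_nth fps_X_power_mult_nth) simp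
  \<comment> \<open>At least one factor \<open>1 - X\<close> is present, so the correction
    \<open>f(1)\<close> in \<open>residue_sum_rat_cong\<close> drops out.\<close>
  moreover have "poly f 1 = 0"
    using assms by (simp add: f_def)
  ultimately have "rat_cong p ((- 1) ^ d * fps_nth (?E * (?g ^ d * ?u ^ q * ?v)) (?M - d))
      (of_int (residue_sum p r f))"
    using residue_sum_rat_cong[OF prime_p, of r f] by simp
  from rat_cong_sym[OF prime_p this] have "rat_cong p (of_int (residue_sum p r f))
      ((- 1) ^ d * fps_nth (?E * (?b ^ ?s * - bernoulli_log_fps)) (?M - d))"
    by (rule rat_cong_trans[OF prime_p])
      (intro rat_cong_mult_left[OF prime_p _ 1] p_adic_integral_power p_adic_integral_uminus
        p_adic_integral_1 prime_p)
  from rat_cong_uminus[OF prime_p this] have "rat_cong p (- of_int (residue_sum p r f))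
      (- ((- 1) ^ d * fps_nth (?E * (?b ^ ?s * - bernoulli_log_fps)) (?M - d)))" .
  also have "?E * (?b ^ ?s * - bernoulli_log_fps) = - (bernoulli_log_fps * (?b ^ ?s * ?E))"
    by (simp add: mult_ac)
  finally show ?thesis
    by (simp add: f_def)
qed

end

text \<open>Wilson's theorem is the case \<open>a = 0\<close>. Moving one factor across replaces
  \<open>c + 1\<close> by \<open>a + 1\<close>, and these add up to \<open>p\<close>, so only the
  sign changes.\<close>

lemma fact_mult_fact_cong:
  assumes "prime p" "a + c = p - 1"
  shows "[fact a * fact c = (- 1) ^ Suc a] (mod int p)"
  using assms(2)
proof (induction a arbitrary: c)
  case 0
  then show ?case
    using wilson_theorem[OF assms(1)] by simp
next
  case (Suc a)
  have "[fact a * fact (Suc c) = (- 1) ^ Suc a] (mod int p)"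
    using Suc.prems by (intro Suc.IH) simp
  then have "int p dvd fact a * fact (Suc c) - (- 1) ^ Suc a"
    by (simp only: cong_iff_dvd_diff)
  moreover have "int p = int (Suc a) + int (Suc c)"
    using Suc.prems prime_gt_0_nat[OF assms(1)] by linarith
  then have "fact (Suc a) * fact c - (- 1) ^ Suc (Suc a) =
      int p * (fact a * fact c) - (fact a * fact (Suc c) - (- 1) ^ Suc a)"
    by (simp add: algebra_simps)
  ultimately show ?case
    unfolding cong_iff_dvd_diff by (simp only: dvd_diff dvd_triv_left)
qed

text \<open>The quotient \<open>q\<close> is an integer so that \<open>n = 0\<close> is covered by
  \<open>q = -1\<close> and \<open>d = p - 1\<close>.\<close>

lemma lower_upper_star:
  assumes "0 < d" "d \<le> p - 1" "int n = int (p - 1) * q + int d"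
  shows "lower_star p n = d" "upper_star p n = p - 1 - d"
proof -
  have cong_iff: "[k = n] (mod (p - 1)) \<longleftrightarrow> [k = d] (mod (p - 1))" for k
    unfolding cong_int_iff[symmetric] assms(3) by (simp add: cong_def)
  show "lower_star p n = d"
    unfolding lower_star_def cong_iff
  proof (rule Least_equality)
    fix k assume k: "0 < k \<and> [k = d] (mod (p - 1))"
    show "d \<le> k"
    proof (rule ccontr)
      assume "\<not> d \<le> k"
      then have "k < p - 1" "d < p - 1 \<or> d = p - 1"
        using assms by auto
      then show False
        using k \<open>\<not> d \<le> k\<close> by (auto simp: cong_def)
    qed
  qed (use assms in simp)
  have "- int n = int (p - 1 - d) + int (p - 1) * (- q - 1)"
    using assms by (simp add: of_nat_diff algebra_simps)
  then have "(- int n) mod int (p - 1) = int (p - 1 - d)"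
    using assms by (simp only: mod_mult_self2) simp
  moreover have "int (p - 1) = int p - 1"
    using assms by (simp add: of_nat_diff)
  ultimately show "upper_star p n = p - 1 - d"
    unfolding upper_star_def least_nonneg_residue_def by (metis nat_int)
qed

text \<open>Expanding \<open>e^(-rx)\<close> gives powers of \<open>r\<close> over
  \<open>(N - k)!\<close>. As \<open>d + k\<close> and \<open>N - k\<close> add up to
  \<open>p - 1\<close>, this reciprocal is \<open>(d + k)!\<close> up to sign modulo
  \<open>p\<close>, and \<open>(d + k)! = d! k! binom(d + k, d)\<close> yields the new
  binomials.\<close>

lemma bernoulli_sums_cong:
  assumes "prime p" "0 < d" "d + N = p - 1"
  shows "rat_cong p
    ((- 1) ^ N * fps_nth (bernoulli_log_fps * (bernoulli_fps ^ s * fps_exp (- of_int r))) N)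
    ((-1) ^ (d - 1) * fact d *
        (\<Sum>k\<in>{1<..N}. of_nat ((d + k) choose d) * of_int r ^ (N - k) *
          (\<Sum>j\<in>{1<..k}.
            of_nat (k choose j) * (bernoulli_number j / of_nat j) *
            bernoulli_poly_order s (k - j) 0)))"
proof -
  let ?L = "bernoulli_log_fps * bernoulli_fps ^ s"
  have "fps_integral p (p - 1) ?L"
    using assms(1)
    by (intro fps_integral_mult fps_integral_power fps_integral_bernoulli fps_integral_bernoulli_log)
  then have integral: "p_adic_integral p (fps_nth ?L k)" if "k \<le> N" for k
    using that assms by (simp add: fps_integral_def)
  have "(- 1) ^ N * fps_nth (bernoulli_log_fps * (bernoulli_fps ^ s * fps_exp (- of_int r))) N =
      (\<Sum>k\<in>{0..N}. fps_nth ?L k * ((- 1) ^ N * (- of_int r) ^ (N - k) / fact (N - k)))"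
    unfolding mult.assoc[of bernoulli_log_fps, symmetric] fps_mult_nth[of ?L]
    by (simp add: sum_distrib_left mult_ac)
  also have "\<dots> = (\<Sum>k\<in>{1<..N}. fps_nth ?L k * ((- 1) ^ N * (- of_int r) ^ (N - k) / fact (N - k)))"
  proof (intro sum.mono_neutral_right ballI)
    fix k assume "k \<in> {0..N} - {1<..N}"
    then have "k \<le> 1"
      by auto
    then have "fps_nth ?L k = 0"
      unfolding fps_mult_nth by (intro sum.neutral) (auto simp: bernoulli_log_fps_def)
    then show "fps_nth ?L k * ((- 1) ^ N * (- of_int r) ^ (N - k) / fact (N - k)) = 0"
      by simp
  qed auto
  also have "rat_cong p \<dots>
      (\<Sum>k\<in>{1<..N}. fps_nth ?L k * ((- 1) ^ (d - 1) * fact (d + k) * of_int r ^ (N - k)))"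
  proof (intro rat_cong_sum rat_cong_mult_left assms(1) integral)
    fix k assume k: "k \<in> {1<..N}"
    have "[fact (d + k) * fact (N - k) = (- 1) ^ Suc (d + k)] (mod int p)"
      using k assms by (intro fact_mult_fact_cong) auto
    then have "[(- 1) ^ (d - 1) * r ^ (N - k) * (fact (d + k) * fact (N - k)) =
        (- 1) ^ (d - 1) * r ^ (N - k) * (- 1) ^ Suc (d + k)] (mod int p)"
      by (intro cong_mult cong_refl)
    also have "(- 1) ^ (d - 1) * r ^ (N - k) * (- 1) ^ Suc (d + k) = (- 1) ^ N * (- r) ^ (N - k)"
    proof -
      obtain e j where "d = Suc e" "N = j + k"
        using assms(2) k by (metis Suc_pred add.commute greaterThanAtMost_iff le_Suc_ex)
      then show ?thesis
        by (simp add: power_minus[of r] minus_one_power_iff)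
    qed
    finally have "[(- 1) ^ N * (- r) ^ (N - k) =
        ((- 1) ^ (d - 1) * fact (d + k) * r ^ (N - k)) * fact (N - k)] (mod int p)"
      by (simp only: cong_sym_eq mult_ac)
    moreover have "N - k < p"
      using assms prime_gt_0_nat[OF assms(1)] by linarith
    ultimately show "rat_cong p ((- 1) ^ N * (- of_int r) ^ (N - k) / fact (N - k))
        ((- 1) ^ (d - 1) * fact (d + k) * of_int r ^ (N - k))"
      using rat_cong_divide_fact[OF assms(1)] by fastforce
  qed auto
  also have "(\<Sum>k\<in>{1<..N}. fps_nth ?L k * ((- 1) ^ (d - 1) * fact (d + k) * of_int r ^ (N - k))) =
      (-1) ^ (d - 1) * fact d *
        (\<Sum>k\<in>{1<..N}. of_nat ((d + k) choose d) * of_int r ^ (N - k) *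
          (fact k * fps_nth ?L k))"
    unfolding sum_distrib_left
  proof (intro sum.cong refl)
    fix k
    have "fact (d + k) = fact d * fact k * (of_nat ((d + k) choose d) :: rat)"
      using binomial_fact_lemma[of d "d + k"]
      by (metis add_diff_cancel_left' le_add1 of_nat_fact of_nat_mult)
    then show "fps_nth ?L k * ((- 1) ^ (d - 1) * fact (d + k) * of_int r ^ (N - k)) =
        (- 1) ^ (d - 1) * fact d * (of_nat ((d + k) choose d) * of_int r ^ (N - k) *
          (fact k * fps_nth ?L k))"
      by (simp only: mult_ac)
  qed
  finally show ?thesis
    unfolding bernoulli_sum_eq by simp
qed

text \<open>For \<open>p = 2\<close> or \<open>n = 0\<close> the upper star is \<open>0\<close>, and
  the right side is the constant coefficient of a multiple of \<open>bernoulli_log_fps\<close>,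
  which vanishes.\<close>

lemma fleck_quotient_diff_cong_less:
  assumes "prime p" "n < m" "[m = n] (mod (p * (p - 1)))"
  shows "rat_cong p
    ((fleck_quotient p m r - fleck_quotient p n r) / (of_nat m - of_nat n))
    ((- 1) ^ upper_star p n * fps_nth (bernoulli_log_fps *
      (bernoulli_fps ^ least_nonneg_residue (- int n) (int p) * fps_exp (- of_int r)))
      (upper_star p n))"
proof -
  have "p * (p - 1) dvd m - n"
    using assms by (simp add: cong_altdef_nat cong_sym_eq)
  then obtain t where t: "m - n = p * (p - 1) * t" ..
  then have m: "m = n + p * (p - 1) * t"
    using assms(2) by simp
  have "t > 0"
    using assms(2) m by (cases t) auto
  obtain U :: "int poly"
    where U: "[:1, -1:] ^ p = 1 - [:0, 1:] ^ p - of_nat p * U * [:1, -1:]"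
    using one_minus_X_power_prime_ex[OF assms(1)] by blast
  obtain V where "U ^ p - pcompose U ([:0, 1:] ^ p) = of_nat p * V"
    using prime_dvd_power_diff_pcompose[OF assms(1), of U] ..
  then have V: "U ^ p = pcompose U ([:0, 1:] ^ p) + of_nat p * V"
    by (simp add: algebra_simps)
  have p: "p \<ge> 2"
    using assms(1) by (rule prime_ge_2_nat)
  \<comment> \<open>For \<open>n = 0\<close> the smallest positive residue is \<open>p - 1\<close>;
    truncated subtraction would give \<open>1\<close>.\<close>
  define d q where "d = (if n = 0 then p - 1 else Suc ((n - 1) mod (p - 1)))"
    and "q = (n - 1) div (p - 1)"
  have d: "0 < d" "d \<le> p - 1"
    using p by (auto simp: d_def Suc_le_eq)
  have n: "n = (p - 1) * q + d" if "n \<noteq> 0"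
    using that by (simp add: d_def q_def)
  have "int n = int (p - 1) * (if n = 0 then - 1 else int q) + int d"
  proof (cases "n = 0")
    case False
    then show ?thesis
      using arg_cong[OF n[OF False], of int] by (simp only: of_nat_add of_nat_mult if_False)
  qed (simp add: d_def)
  from lower_upper_star[OF d this] have upper: "upper_star p n = p - 1 - d"
    by simp
  show ?thesis
  proof (cases "odd p")
    case False
    then have "p = 2"
      using assms(1) primes_dvd_imp_eq two_is_prime_nat by blast
    then have "fleck_quotient p m r = fleck_quotient p n r"
      using fleck_quotient_2[OF assms(1) U, of n t r] m by simp
    moreover have "upper_star p n = 0"
      using upper \<open>p = 2\<close> d by simp
    ultimately show ?thesis
      using rat_cong_refl[OF assms(1)] by (simp add: bernoulli_log_fps_def)
  next
    case True
    have "of_nat (p * (p - 1) * t) = (of_nat m - of_nat n :: rat)"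
      unfolding m by simp
    note 1 = fleck_quotient_diff_cong[OF assms(1) U V True \<open>t > 0\<close>, of n r,
        folded m q_def, unfolded this]
    show ?thesis
    proof (cases "n = 0")
      case True
      then show ?thesis
        using 1 upper by (simp add: d_def bernoulli_log_fps_def)
    next
      case False
      have d': "Suc ((n - 1) mod (p - 1)) = d"
        using False by (simp add: d_def)
      \<comment> \<open>For odd \<open>p\<close> the number \<open>p - 1\<close> is even, so the
        sign from the \<open>d\<close> factors \<open>1 - X\<close> is the sign belonging to the
        upper star.\<close>
      have "(- 1) ^ d = ((- 1) ^ (p - 1 - d) :: rat)"
        using \<open>odd p\<close> d by (auto simp: minus_one_power_iff)
      \<comment> \<open>The order of the Bernoulli polynomials: \<open>n = (p - 1) q + d\<close>
        gives \<open>- n = q + (p - 1) d - p (q + d)\<close>.\<close>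
      moreover have "least_nonneg_residue (- int n) (int p) = (q + (p - 1) * d) mod p"
      proof -
        have "- int n = int (q + (p - 1) * d) + int p * (- int q - int d)"
        proof -
          obtain M where M: "p = Suc M"
            using p by (cases p) auto
          show ?thesis
            using n[OF False] unfolding M by (simp add: algebra_simps)
        qed
        then have "(- int n) mod int p = int (q + (p - 1) * d) mod int p"
          by (simp only: mod_mult_self2)
        then show ?thesis
          unfolding least_nonneg_residue_def by (metis nat_int zmod_int)
      qed
      moreover have "rat_cong p
        ((fleck_quotient p m r - fleck_quotient p n r) / (of_nat m - of_nat n))
        (- of_int (residue_sum p r ([:1, -1:] ^ d * U ^ q * V)))"
        using 1 unfolding if_not_P[OF False] d' .
      note rat_cong_trans[OF assms(1) this residue_sum_bernoulli_cong[OF assms(1) U V d]]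
      ultimately show ?thesis
        by (simp only: upper)
    qed
  qed
qed

theorem theorem1p1:
  fixes p m n :: nat and r :: int
  assumes "prime p" and "m \<noteq> n" and "[m = n] (mod (p * (p - 1)))"
  shows "rat_cong p
      ((fleck_quotient p m r - fleck_quotient p n r) / (of_nat m - of_nat n))
      ((-1) ^ upper_star p n / fact (upper_star p n) *
        (\<Sum>k\<in>{1<..upper_star p n}.
          of_nat (upper_star p n choose k) * (bernoulli_number k / of_nat k) *
          bernoulli_poly_order (least_nonneg_residue (- int n) (int p))
            (upper_star p n - k) (- of_int r)))
    \<and> rat_cong p
      ((-1) ^ upper_star p n / fact (upper_star p n) *
        (\<Sum>k\<in>{1<..upper_star p n}.
          of_nat (upper_star p n choose k) * (bernoulli_number k / of_nat k) *
          bernoulli_poly_order (least_nonneg_residue (- int n) (int p))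
            (upper_star p n - k) (- of_int r)))
      ((-1) ^ (lower_star p n - 1) * fact (lower_star p n) *
        (\<Sum>k\<in>{1<..upper_star p n}.
          of_nat ((lower_star p n + k) choose lower_star p n) *
          of_int r ^ (upper_star p n - k) *
          (\<Sum>j\<in>{1<..k}.
            of_nat (k choose j) * (bernoulli_number j / of_nat j) *
            bernoulli_poly_order (least_nonneg_residue (- int n) (int p)) (k - j) 0)))"
proof -
  have p: "p \<ge> 2"
    using assms(1) by (rule prime_ge_2_nat)
  have n: "\<exists>d q. 0 < d \<and> d \<le> p - 1 \<and> int n = int (p - 1) * q + int d"
  proof (cases "n = 0")
    case True
    then show ?thesis
      using p by (intro exI[of _ "p - 1"] exI[of _ "-1"]) auto
  next
    case False
    have "n = (p - 1) * ((n - 1) div (p - 1)) + Suc ((n - 1) mod (p - 1))"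
      using False by simp
    then have "int n = int (p - 1) * int ((n - 1) div (p - 1)) + int (Suc ((n - 1) mod (p - 1)))"
      by (metis of_nat_add of_nat_mult)
    then show ?thesis
      using p
      by (metis Suc_le_eq mod_less_divisor zero_less_Suc zero_less_diff less_le_trans
          one_less_numeral_iff semiring_norm(76))
  qed
  then obtain d q where d: "0 < d" "d \<le> p - 1" "int n = int (p - 1) * q + int d"
    by blast
  have star: "0 < lower_star p n" "lower_star p n + upper_star p n = p - 1"
    using lower_upper_star[OF d] d(1,2) by simp_all
  have "[int m = int n] (mod int p * int (p - 1))"
    using assms(3) by (simp flip: cong_int_iff)
  then have "int p * int (p - 1) dvd int m - int n"
    by (simp add: cong_iff_dvd_diff)
  then have "int p dvd int m - int n" "int (p - 1) dvd int m - int n"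
    by (auto elim: dvd_mult_left dvd_mult_right)
  then have "(- int m) mod int p = (- int n) mod int p"
      "(- int m) mod int (p - 1) = (- int n) mod int (p - 1)"
    by (simp_all add: mod_eq_dvd_iff dvd_diff_commute)
  moreover have "int (p - 1) = int p - 1"
    using p by (simp add: of_nat_diff)
  ultimately have eq: "upper_star p m = upper_star p n"
      "least_nonneg_residue (- int m) (int p) = least_nonneg_residue (- int n) (int p)"
    by (simp_all add: upper_star_def least_nonneg_residue_def)
  have "rat_cong p
    ((fleck_quotient p m r - fleck_quotient p n r) / (of_nat m - of_nat n))
    ((- 1) ^ upper_star p n * fps_nth (bernoulli_log_fps *
      (bernoulli_fps ^ least_nonneg_residue (- int n) (int p) * fps_exp (- of_int r)))
      (upper_star p n))"
  proof (cases "n < m")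
    case True
    then show ?thesis
      using fleck_quotient_diff_cong_less[OF assms(1)] assms(3) by blast
  next
    case False
    then have "m < n"
      using assms(2) by simp
    \<comment> \<open>The difference quotient is symmetric, and both the upper star and the order
      agree for \<open>m\<close> and \<open>n\<close>, so exchanging the two is harmless.\<close>
    have "(x - y) / (a - b) = (y - x) / (b - a)" for x y a b :: rat
      by (metis minus_diff_eq minus_divide_divide)
    then show ?thesis
      using fleck_quotient_diff_cong_less[OF assms(1) \<open>m < n\<close> cong_sym[OF assms(3)], of r]
      unfolding eq by metis
  qed
  then show ?thesis
    using bernoulli_sums_cong[OF assms(1) star, of _ r] unfolding bernoulli_sum_eq by simp
qed

end
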